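(* Let $\varphi \in \Phi_3$ be such that $\varphi(t) = 0$ for all $t \geq \pi$. Then the restriction $\psi = \varphi|_{[0,\pi]}$ of $\varphi$ to the interval $[0,\pi]$ belongs to the class $\Psi_3^+$.
   Context: Let $\|\cdot\|$ be the Euclidean norm and $\langle\cdot,\cdot\rangle$ the Euclidean inner product. For a set $X$, a function $h: X\times X\to\mathbb{R}$ is positive definite if $\sum_{i=1}^n\sum_{j=1}^n c_i c_j h(x_i,x_j)\ge 0$ for all finite systems of pairwise distinct points $x_1,\ldots,x_n\in X$ and all $c_1,\ldots,c_n\in\mathbb{R}$; it is strictly positive definite if in addition the inequality is strict unless $c_1=\cdots=c_n=0$. The class $\Phi_d$ ($d \geq 1$ an integer) consists of the continuous functions $\varphi:[0,\infty)\to\mathbb{R}$ with $\varphi(0)=1$ such that $h(x,y)=\varphi(\|x-y\|)$ is positive definite on $\mathbb{R}^d$. Let $\mathbb{S}^d=\{x\in\mathbb{R}^{d+1}:\|x\|=1\}$ and let $\theta(x,y)=\arccos(\langle x,y\rangle)\in[0,\pi]$ be the great circle distance on $\mathbb{S}^d$. The class $\Psi_d^+$ consists of the continuous functions $\psi:[0,\pi]\to\mathbb{R}$ with $\psi(0)=1$ such that $h(x,y)=\psi(\theta(x,y))$ is strictly positive definite on $\mathbb{S}^d$. *)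

theory Defs
  imports "HOL-Analysis.Analysis"
begin

definition pos_def_on :: "'a set \<Rightarrow> ('a \<Rightarrow> 'a \<Rightarrow> real) \<Rightarrow> bool" where
  "pos_def_on X h \<longleftrightarrow>
     (\<forall>(n::nat) (x :: nat \<Rightarrow> 'a) (c :: nat \<Rightarrow> real).
        x ` {1..n} \<subseteq> X \<and> inj_on x {1..n} \<longrightarrow>
        (\<Sum>i=1..n. \<Sum>j=1..n. c i * c j * h (x i) (x j)) \<ge> 0)"

definition strict_pos_def_on :: "'a set \<Rightarrow> ('a \<Rightarrow> 'a \<Rightarrow> real) \<Rightarrow> bool" where
  "strict_pos_def_on X h \<longleftrightarrow>
     pos_def_on X h \<and>
     (\<forall>(n::nat) (x :: nat \<Rightarrow> 'a) (c :: nat \<Rightarrow> real).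
        x ` {1..n} \<subseteq> X \<and> inj_on x {1..n} \<and> \<not> (\<forall>i\<in>{1..n}. c i = 0) \<longrightarrow>
        (\<Sum>i=1..n. \<Sum>j=1..n. c i * c j * h (x i) (x j)) > 0)"

definition great_circle_dist :: "'a::euclidean_space \<Rightarrow> 'a \<Rightarrow> real" where
  "great_circle_dist x y = arccos (x \<bullet> y)"

(* Functions on [0,\<infinity>) and on [0,pi] are total functions of which only the values on
   these sets matter.  The class with index d is Phi_class TYPE(real ^ 'n) with CARD('n) = d. *)

definition Phi_class :: "'a::euclidean_space itself \<Rightarrow> (real \<Rightarrow> real) set" where
  "Phi_class _ = {\<phi>. continuous_on {0..} \<phi> \<and> \<phi> 0 = 1 \<and>
     pos_def_on (UNIV :: 'a set) (\<lambda>x y. \<phi> (norm (x - y)))}"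

(* The argument is the ambient space of the sphere: the class with index d, for the
   d-dimensional sphere, is Psi_plus_class TYPE(real ^ 'n) with CARD('n) = d + 1. *)

definition Psi_plus_class :: "'a::euclidean_space itself \<Rightarrow> (real \<Rightarrow> real) set" where
  "Psi_plus_class _ = {\<psi>. continuous_on {0..pi} \<psi> \<and> \<psi> 0 = 1 \<and>
     strict_pos_def_on (sphere (0::'a) 1) (\<lambda>x y. \<psi> (great_circle_dist x y))}"

end

theory Submission
  imports Defs "HOL-Complex_Analysis.Conformal_Mappings"
begin

text \<open>
  Write \<open>f u = \<integral>\<^sub>0\<^sup>\<pi> \<phi> t cos (u t) dt\<close>. Positive definiteness of \<open>\<phi>\<close> on three-dimensional space says that
  the three-dimensional Fourier transform of the radial function is nonnegative, that is,
  \<open>- f' u = \<integral>\<^sub>0\<^sup>\<pi> t \<phi> t sin (u t) dt \<ge> 0\<close> for \<open>u \<ge> 0\<close>. Since \<open>f\<close> is entire and not constant, it is strictly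
  decreasing on the positive half-line. The coefficient of \<open>\<phi>\<close> on the three-sphere at the zonal harmonic
  \<open>U\<^sub>n (cos \<theta>) = sin ((n + 1) \<theta>) / sin \<theta>\<close> is \<open>(f n - f (n + 2)) / \<pi>\<close>, so all coefficients are strictly
  positive. Each \<open>U\<^sub>n (x \<bullet> y)\<close> is positive definite, being a character of \<open>SU(2)\<close>; a null vector of the
  quadratic form of \<open>\<phi>\<close> is annihilated by all of them, hence by every polynomial in \<open>x \<bullet> y\<close>, hence is zero.
\<close>

subsection \<open>Chebyshev polynomials of the second kind\<close>

text \<open>Because \<open>\<phi>\<close> vanishes from \<open>pi\<close> on, integrals over
  \<open>{0..pi}\<close> are at once Euclidean transforms and spherical coefficients, and in
  dimension three both involve only sines and cosines. The sign of the sine transform comes from the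
  projection-slice principle. Integrating the kernel over two coordinates leaves a positive definite
  kernel \<open>k (s - t)\<close> on the line, whose cosine transform is nonnegative; the derivative
  of \<open>k\<close> at \<open>s > 0\<close> is a negative multiple of \<open>s * \<phi> s\<close>,
  so one integration by parts yields the claim. The remaining obstacle is convergence. The
  coefficients belong to the sine series of \<open>\<phi> t * sin t\<close>, and dividing by
  \<open>sin t\<close> costs a factor \<open>n + 1\<close> near the endpoints. Since
  \<open>\<phi>\<close> is merely continuous, no smoothness supplies decay. Positivity of the
  coefficients replaces it: growth of \<open>\<phi> t * sin t\<close> that is at most linear near 0
  already bounds the sum of \<open>(n + 1) * b n\<close>.\<close>

fun chebU :: "nat \<Rightarrow> real \<Rightarrow> real" where
  "chebU 0 t = 1"
| "chebU (Suc 0) t = 2 * t"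
| "chebU (Suc (Suc n)) t = 2 * t * chebU (Suc n) t - chebU n t"

lemma sin_mult_chebU_cos: "sin x * chebU n (cos x) = sin (real (Suc n) * x)"
proof (induction n "cos x" rule: chebU.induct)
  case 2
  then show ?case by (simp add: sin_double)
next
  case (3 n)
  have "sin (real (Suc (Suc (Suc n))) * x) + sin (real (Suc n) * x)
      = 2 * cos x * sin (real (Suc (Suc n)) * x)"
    using sin_add[of "real (Suc (Suc n)) * x" x] sin_diff[of "real (Suc (Suc n)) * x" x]
    by (simp add: algebra_simps)
  with 3 show ?case by (simp add: algebra_simps)
qed simp

lemma continuous_on_chebU [continuous_intros]:
  "continuous_on S f \<Longrightarrow> continuous_on S (\<lambda>x. chebU n (f x))"
proof (induction n "0::real" rule: chebU.induct)
qed (auto intro!: continuous_intros)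

lemma abs_sin_nat_mult_le: "\<bar>sin (real n * x)\<bar> \<le> real n * \<bar>sin x\<bar>"
proof (induction n)
  case (Suc n)
  have "\<bar>sin (real (Suc n) * x)\<bar> \<le> \<bar>sin (real n * x)\<bar> * \<bar>cos x\<bar> + \<bar>cos (real n * x)\<bar> * \<bar>sin x\<bar>"
    using abs_triangle_ineq[of "sin (real n * x) * cos x" "cos (real n * x) * sin x"]
    by (simp add: sin_add ring_distribs abs_mult add.commute mult.commute)
  also have "\<dots> \<le> \<bar>sin (real n * x)\<bar> * 1 + 1 * \<bar>sin x\<bar>"
    by (intro add_mono mult_left_mono mult_right_mono) auto
  finally show ?case using Suc by (simp add: algebra_simps)
qed simp

text \<open>Division by \<open>sin x\<close> is possible only inside the interval, so the endpoints
  are reached by continuity. This bound produces the weight \<open>real (Suc n)\<close> in the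
  convergence proof of the expansion.\<close>

lemma abs_chebU_le:
  assumes "\<bar>t\<bar> \<le> 1"
  shows "\<bar>chebU n t\<bar> \<le> real (Suc n)"
proof -
  have *: "\<bar>chebU n t\<bar> \<le> real (Suc n)" if "t \<in> {-1<..<1}" for t
  proof -
    define x where "x = arccos t"
    have x: "cos x = t" "sin x > 0"
      using that arccos_lt_bounded[of t] by (auto simp: x_def sin_gt_zero)
    have "\<bar>sin x\<bar> * \<bar>chebU n t\<bar> \<le> real (Suc n) * \<bar>sin x\<bar>"
      using abs_sin_nat_mult_le[of "Suc n" x] by (simp only: x flip: abs_mult sin_mult_chebU_cos)
    then show ?thesis using x by (simp add: mult.commute)
  qed
  have "\<bar>chebU n t\<bar> \<le> real (Suc n)"
  proof (rule continuous_le_on_closure[where f = "\<lambda>t. \<bar>chebU n t\<bar>"])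
    show "continuous_on (closure {-1<..<1}) (\<lambda>t. \<bar>chebU n t\<bar>)"
      by (intro continuous_intros)
    show "t \<in> closure {-1<..<1}" using assms by auto
  qed (use * in auto)
  then show ?thesis .
qed

lemma power_eq_sum_chebU: "\<exists>a N. \<forall>t. t ^ k = (\<Sum>n\<le>N. a n * chebU n t)"
proof (induction k)
  case 0
  show ?case by (rule exI[of _ "\<lambda>_. 1"], rule exI[of _ 0]) simp
next
  case (Suc k)
  then obtain a N where a: "t ^ k = (\<Sum>n\<le>N. a n * chebU n t)" for t by blast
  have step: "\<exists>b. \<forall>t. t * (\<Sum>n\<le>M. a n * chebU n t) = (\<Sum>n\<le>Suc M. b n * chebU n t)" for M
  proof (induction M)
    case 0
    show ?case by (rule exI[of _ "\<lambda>n. if n = 1 then a 0 / 2 else 0"]) simp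
  next
    case (Suc M)
    then obtain b where b: "t * (\<Sum>n\<le>M. a n * chebU n t) = (\<Sum>n\<le>Suc M. b n * chebU n t)" for t
      by blast
    \<comment> \<open>The recurrence reads \<open>t * U(M+1) = (U(M+2) + U(M)) / 2\<close>, so the
      new term feeds two indices. The guard on \<open>b\<close> is needed because its value beyond
      \<open>Suc M\<close> is arbitrary.\<close>
    define b' where "b' n = (if n \<le> Suc M then b n else 0) +
       (if n = Suc (Suc M) then a (Suc M) / 2 else 0) + (if n = M then a (Suc M) / 2 else 0)" for n
    have "t * (\<Sum>n\<le>Suc M. a n * chebU n t) = (\<Sum>n\<le>Suc (Suc M). b' n * chebU n t)" for t
    proof -
      have "(\<Sum>n\<le>Suc (Suc M). b' n * chebU n t) =
        (\<Sum>n\<le>Suc (Suc M). (if n \<le> Suc M then b n else 0) * chebU n t) +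
        (\<Sum>n\<le>Suc (Suc M). if n = Suc (Suc M) then a (Suc M) / 2 * chebU n t else 0) +
        (\<Sum>n\<le>Suc (Suc M). if n = M then a (Suc M) / 2 * chebU n t else 0)"
        unfolding sum.distrib[symmetric] by (intro sum.cong) (auto simp: b'_def algebra_simps)
      also have "\<dots> = (\<Sum>n\<le>Suc M. b n * chebU n t) + a (Suc M) / 2 * (chebU (Suc (Suc M)) t + chebU M t)"
        by (simp add: sum.delta algebra_simps del: chebU.simps)
      also have "\<dots> = t * (\<Sum>n\<le>Suc M. a n * chebU n t)"
        unfolding b[symmetric] by (simp add: algebra_simps)
      finally show ?thesis by simp
    qed
    then show ?case by blast
  qed
  then obtain b where "t * (\<Sum>n\<le>N. a n * chebU n t) = (\<Sum>n\<le>Suc N. b n * chebU n t)" for t by blast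
  then have "\<forall>t. t ^ Suc k = (\<Sum>n\<le>Suc N. b n * chebU n t)" using a by simp
  then show ?case by blast
qed

subsection \<open>Symmetric powers of \<open>2 \<times> 2\<close> matrices\<close>

text \<open>A matrix is listed row by row. Row \<open>k\<close> of its \<open>n\<close>-th symmetric power holds the image of \<open>X\<^sup>k Y\<^sup>n\<^sup>-\<^sup>k\<close>,
  dehomogenized by \<open>Y = 1\<close>; it is meaningful for \<open>k \<le> n\<close> only.\<close>

type_synonym mat2 = "complex \<times> complex \<times> complex \<times> complex"

fun mul2 :: "mat2 \<Rightarrow> mat2 \<Rightarrow> mat2" where
  "mul2 (a, b, c, d) (a', b', c', d') = (a * a' + b * c', a * b' + b * d', c * a' + d * c', c * b' + d * d')"

fun adj2 :: "mat2 \<Rightarrow> mat2" where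
  "adj2 (a, b, c, d) = (cnj a, cnj c, cnj b, cnj d)"

fun sym_row :: "nat \<Rightarrow> mat2 \<Rightarrow> nat \<Rightarrow> complex poly" where
  "sym_row n (a, b, c, d) k = [:b, a:] ^ k * [:d, c:] ^ (n - k)"

definition sym_pow :: "nat \<Rightarrow> mat2 \<Rightarrow> nat \<Rightarrow> nat \<Rightarrow> complex" where
  "sym_pow n A k l = coeff (sym_row n A k) l"

definition sym_trace :: "nat \<Rightarrow> mat2 \<Rightarrow> complex" where
  "sym_trace n A = (\<Sum>k\<le>n. sym_pow n A k k)"

text \<open>Restoring the second variable turns multiplication by a linear polynomial into
  multiplication by a linear form. The degree bound makes the coefficient at \<open>Suc n\<close> of
  the part \<open>b * p\<close> vanish, so no exponent is lost in the truncated subtraction.\<close>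

lemma homogenization_linear_mult:
  fixes p :: "complex poly"
  assumes "degree p \<le> n"
  shows "(\<Sum>l\<le>Suc n. coeff ([:b, a:] * p) l * u ^ l * v ^ (Suc n - l))
       = (a * u + b * v) * (\<Sum>l\<le>n. coeff p l * u ^ l * v ^ (n - l))"
proof -
  have "(\<Sum>l\<le>Suc n. coeff ([:b, a:] * p) l * u ^ l * v ^ (Suc n - l))
      = (\<Sum>l\<le>Suc n. b * coeff p l * u ^ l * v ^ (Suc n - l))
        + (\<Sum>l\<le>Suc n. a * coeff (pCons 0 p) l * u ^ l * v ^ (Suc n - l))"
    unfolding sum.distrib[symmetric]
    by (intro sum.cong) (auto simp: algebra_simps coeff_pCons split: nat.split)
  also have "(\<Sum>l\<le>Suc n. b * coeff p l * u ^ l * v ^ (Suc n - l))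
      = (\<Sum>l\<le>n. b * v * (coeff p l * u ^ l * v ^ (n - l)))"
    using assms by (auto simp: coeff_eq_0 Suc_diff_le intro!: sum.cong)
  also have "(\<Sum>l\<le>Suc n. a * coeff (pCons 0 p) l * u ^ l * v ^ (Suc n - l))
      = (\<Sum>l\<le>n. a * u * (coeff p l * u ^ l * v ^ (n - l)))"
    by (subst sum.atMost_Suc_shift) (auto intro!: sum.cong)
  finally show ?thesis by (simp only: sum_distrib_left[symmetric] distrib_right add.commute)
qed

lemma degree_linear_power_mult_le:
  "degree ([:b, a:] ^ k * [:d, c:] ^ m :: complex poly) \<le> k + m"
  by (rule order.trans[OF degree_mult_le add_mono])
     (auto intro!: order.trans[OF degree_power_le])

lemma homogenization_linear_powers:
  fixes a b c d u v :: complex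
  shows "(\<Sum>l\<le>k + m. coeff ([:b, a:] ^ k * [:d, c:] ^ m) l * u ^ l * v ^ (k + m - l))
       = (a * u + b * v) ^ k * (c * u + d * v) ^ m"
proof (induction k)
  case 0
  show ?case
  proof (induction m)
    case (Suc m)
    have "degree ([:d, c:] ^ m) \<le> m" using degree_linear_power_mult_le[of b a 0 d c m] by simp
    from homogenization_linear_mult[OF this, of d c u v] Suc show ?case by simp
  qed simp
next
  case (Suc k)
  from homogenization_linear_mult[OF degree_linear_power_mult_le[of b a k d c m], of b a u v] Suc
  show ?case by (simp only: add_Suc power_Suc mult.assoc)
qed

lemma sum_sym_pow:
  assumes "k \<le> n"
  shows "(\<Sum>l\<le>n. sym_pow n (a, b, c, d) k l * u ^ l * v ^ (n - l)) = (a * u + b * v) ^ k * (c * u + d * v) ^ (n - k)"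
  using homogenization_linear_powers[where k = k and m = "n - k"] assms by (simp add: sym_pow_def)

lemma poly_sym_row:
  "poly (sym_row n (a, b, c, d) k) x = (a * x + b) ^ k * (c * x + d) ^ (n - k)"
  by (simp add: poly_power algebra_simps)

text \<open>Composition of substitutions: evaluating the form of row \<open>k\<close> of
  \<open>A\<close> at the two linear forms given by the rows of \<open>B\<close> is the row of the
  product.\<close>

lemma sym_pow_mul2:
  assumes k: "k \<le> n"
  shows "sym_pow n (mul2 A B) k m = (\<Sum>l\<le>n. sym_pow n A k l * sym_pow n B l m)"
proof -
  obtain a b c d a' b' c' d' where AB: "A = (a, b, c, d)" "B = (a', b', c', d')" by (metis prod_cases4)
  have "poly (sym_row n (mul2 A B) k) x = poly (\<Sum>l\<le>n. smult (sym_pow n A k l) (sym_row n B l)) x" for x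
    using sum_sym_pow[OF k, of a b c d "a' * x + b'" "c' * x + d'"]
    unfolding AB mul2.simps poly_sum poly_smult poly_sym_row by (simp add: algebra_simps)
  then have "sym_row n (mul2 A B) k = (\<Sum>l\<le>n. smult (sym_pow n A k l) (sym_row n B l))"
    by (simp flip: poly_eq_poly_eq_iff add: fun_eq_iff)
  then show ?thesis by (simp add: sym_pow_def coeff_sum)
qed

text \<open>In the basis \<open>X\<^sup>k Y\<^sup>n\<^sup>-\<^sup>k\<close> the invariant inner product has weights \<open>1 / (n choose k)\<close>. Both sides are
  coefficients of the \<open>n\<close>-th power of the sesquilinear form of the matrix.\<close>

lemma sym_pow_adj2:
  assumes "k \<le> n" "l \<le> n"
  shows "of_nat (n choose l) * sym_pow n (adj2 A) l k = of_nat (n choose k) * cnj (sym_pow n A k l)"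
proof -
  obtain a b c d where A: "A = (a, b, c, d)" by (metis prod_cases4)
  have eval: "(\<Sum>l\<le>n. sym_pow n (a, b, c, d) k l * x ^ l) = (a * x + b) ^ k * (c * x + d) ^ (n - k)"
    if "k \<le> n" for a b c d x k
    using sum_sym_pow[OF that, of a b c d x 1] by simp
  have cnj_eval: "(\<Sum>l\<le>n. cnj (sym_pow n A k l) * x ^ l) = (cnj a * x + cnj b) ^ k * (cnj c * x + cnj d) ^ (n - k)"
    if "k \<le> n" for x k
    using arg_cong[OF eval[OF that, of a b c d "cnj x"], of cnj] by (simp add: A)
  have "\<forall>k\<le>n. (\<Sum>l\<le>n. of_nat (n choose l) * sym_pow n (adj2 A) l k * x ^ l)
      = (\<Sum>l\<le>n. of_nat (n choose k) * cnj (sym_pow n A k l) * x ^ l)" for x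
  \<comment> \<open>Coefficients of a polynomial in \<open>x\<close> and \<open>y\<close> are
    compared one variable at a time: here in \<open>y\<close> for fixed \<open>x\<close>, and after
    this block in \<open>x\<close>.\<close>
  proof (subst polyfun_eq_coeffs[symmetric], intro allI)
    fix y
    have "(\<Sum>k\<le>n. (\<Sum>l\<le>n. of_nat (n choose l) * sym_pow n (adj2 A) l k * x ^ l) * y ^ k)
        = (\<Sum>l\<le>n. of_nat (n choose l) * x ^ l * (\<Sum>k\<le>n. sym_pow n (adj2 A) l k * y ^ k))"
      unfolding sum_distrib_left sum_distrib_right by (subst sum.swap) (simp add: mult_ac)
    also have "\<dots> = (\<Sum>l\<le>n. of_nat (n choose l) * ((cnj a * y + cnj c) * x) ^ l * (cnj b * y + cnj d) ^ (n - l))"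
      by (intro sum.cong refl, simp only: A adj2.simps atMost_iff eval)
         (simp add: power_mult_distrib mult_ac)
    also have "\<dots> = ((cnj a * y + cnj c) * x + (cnj b * y + cnj d)) ^ n"
      by (rule binomial_ring[symmetric])
    also have "(cnj a * y + cnj c) * x + (cnj b * y + cnj d) = (cnj a * x + cnj b) * y + (cnj c * x + cnj d)"
      by (simp add: algebra_simps)
    also have "\<dots> ^ n = (\<Sum>k\<le>n. of_nat (n choose k) * ((cnj a * x + cnj b) * y) ^ k * (cnj c * x + cnj d) ^ (n - k))"
      by (rule binomial_ring)
    also have "\<dots> = (\<Sum>k\<le>n. of_nat (n choose k) * (\<Sum>l\<le>n. cnj (sym_pow n A k l) * x ^ l) * y ^ k)"
      by (intro sum.cong refl, simp only: atMost_iff cnj_eval)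
         (simp add: power_mult_distrib mult_ac)
    finally show "(\<Sum>k\<le>n. (\<Sum>l\<le>n. of_nat (n choose l) * sym_pow n (adj2 A) l k * x ^ l) * y ^ k)
        = (\<Sum>k\<le>n. (\<Sum>l\<le>n. of_nat (n choose k) * cnj (sym_pow n A k l) * x ^ l) * y ^ k)"
      by (simp add: sum_distrib_left mult.assoc)
  qed
  then show ?thesis
    using assms polyfun_eq_coeffs[where n = n and c = "\<lambda>l. of_nat (n choose l) * sym_pow n (adj2 A) l k"
        and d = "\<lambda>l. of_nat (n choose k) * cnj (sym_pow n A k l)"] by blast
qed

lemma sym_trace_mul2_commute: "sym_trace n (mul2 A B) = sym_trace n (mul2 B A)"
proof -
  have "sym_trace n (mul2 A B) = (\<Sum>k\<le>n. \<Sum>l\<le>n. sym_pow n A k l * sym_pow n B l k)"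
    unfolding sym_trace_def by (intro sum.cong) (auto simp: sym_pow_mul2)
  also have "\<dots> = (\<Sum>l\<le>n. \<Sum>k\<le>n. sym_pow n B l k * sym_pow n A k l)"
    by (subst sum.swap) (simp add: mult.commute)
  also have "\<dots> = sym_trace n (mul2 B A)"
    unfolding sym_trace_def by (intro sum.cong) (auto simp: sym_pow_mul2)
  finally show ?thesis .
qed

lemma sym_trace_diag: "sym_trace n (p, 0, 0, q) = (\<Sum>k\<le>n. p ^ k * q ^ (n - k))"
proof -
  have "[:0, p:] ^ k * [:q:] ^ m = monom (p ^ k * q ^ m) k" for k m
    using smult_power[of p "[:0, 1:]" k] by (simp add: poly_const_pow monom_altdef mult.commute)
  then show ?thesis by (simp add: sym_trace_def sym_pow_def)
qed

text \<open>The sum is the complete homogeneous symmetric polynomial of degree \<open>n\<close> in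
  \<open>p\<close> and \<open>q\<close>. It satisfies
  \<open>h(n+2) = (p + q) h(n+1) - p q h(n)\<close>, which under the hypotheses is the recurrence of
  \<open>chebU\<close>.\<close>

lemma sum_powers_eq_chebU:
  fixes p q :: complex
  assumes "p * q = 1" "p + q = of_real (2 * t)"
  shows "(\<Sum>k\<le>n. p ^ k * q ^ (n - k)) = of_real (chebU n t)"
proof -
  define h where "h n = (\<Sum>k\<le>n. p ^ k * q ^ (n - k))" for n
  have h_p: "h (Suc n) = p * h n + q ^ Suc n" for n
    unfolding h_def by (subst sum.atMost_Suc_shift) (simp add: sum_distrib_left mult.assoc)
  have h_q: "h (Suc n) = q * h n + p ^ Suc n" for n
    unfolding h_def by (auto simp: sum_distrib_left Suc_diff_le mult_ac intro!: sum.cong)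
  have rec: "h (Suc (Suc n)) = (p + q) * h (Suc n) - h n" for n
  proof -
    have "h (Suc (Suc n)) = p * q * h n + p ^ Suc (Suc n) + q ^ Suc (Suc n)"
      unfolding h_p[of "Suc n"] h_q[of n] by (simp add: algebra_simps)
    \<comment> \<open>Written as twice itself minus itself, with one copy expanded by
      \<open>h_p\<close> and the other by \<open>h_q\<close>, so that \<open>p + q\<close>
      appears.\<close>
    then have "h (Suc (Suc n)) = p * h (Suc n) + q ^ Suc (Suc n)
        + (q * h (Suc n) + p ^ Suc (Suc n)) - h (Suc (Suc n))"
      unfolding h_p[of "Suc n", symmetric] h_q[of "Suc n", symmetric] by simp
    also have "\<dots> = (p + q) * h (Suc n) - (h (Suc (Suc n)) - p ^ Suc (Suc n) - q ^ Suc (Suc n))"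
      by (simp add: algebra_simps)
    also have "h (Suc (Suc n)) - p ^ Suc (Suc n) - q ^ Suc (Suc n) = p * q * h n"
      using \<open>h (Suc (Suc n)) = p * q * h n + p ^ Suc (Suc n) + q ^ Suc (Suc n)\<close> by simp
    finally show ?thesis using assms by simp
  qed
  have "h n = of_real (chebU n t)"
  proof (induction n rule: induct_nat_012)
    case (ge2 n)
    then show ?case using rec assms by simp
  qed (use assms in \<open>auto simp: h_def add.commute\<close>)
  then show ?thesis by (simp add: h_def)
qed

text \<open>The trace is invariant under conjugation, so only the eigenvalues
  \<open>Re a \<plusminus> i s\<close> matter. If \<open>b = 0\<close> the matrix is diagonal
  already, and the eigenvector matrix used otherwise would be singular. If
  \<open>b \<noteq> 0\<close> then \<open>\<bar>Re a\<bar> < 1\<close>, so the eigenvalues are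
  distinct.\<close>

lemma sym_trace_SU2:
  assumes norm: "(cmod a)\<^sup>2 + (cmod b)\<^sup>2 = 1"
  shows "sym_trace n (a, b, - cnj b, cnj a) = of_real (chebU n (Re a))"
proof (cases "b = 0")
  case True
  have "a * cnj a = 1" using norm True by (simp add: complex_norm_square[symmetric] flip: of_real_power)
  moreover have "a + cnj a = of_real (2 * Re a)" by (simp add: complex_add_cnj)
  ultimately show ?thesis using True by (simp add: sym_trace_diag sum_powers_eq_chebU)
next
  case False
  define s where "s = sqrt (1 - (Re a)\<^sup>2)"
  have "(Re a)\<^sup>2 < 1"
    using norm False by (smt (verit) cmod_power2 zero_less_norm_iff zero_less_power zero_le_power2)
  then have s: "s > 0" "s\<^sup>2 = 1 - (Re a)\<^sup>2" by (auto simp: s_def)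
  define p q where "p = Complex (Re a) s" and "q = Complex (Re a) (- s)"
  have pq: "p * q = 1" "p + q = a + cnj a" "p + q = of_real (2 * Re a)"
    using s by (auto simp: p_def q_def complex_eq_iff power2_eq_square)
  have det: "b * (q - p) \<noteq> 0" using False s by (auto simp: p_def q_def complex_eq_iff)
  have ab: "a * cnj a + b * cnj b = 1"
    using norm by (metis complex_norm_square of_real_1 of_real_add)
  define e where "e = inverse (b * (q - p))"
  \<comment> \<open>diagonalization by eigenvectors, with \<open>Q\<close> the inverse of \<open>P\<close>\<close>
  define P Q where "P = (b, b, p - a, q - a)" and "Q = (e * (q - a), - e * b, e * (a - p), e * b)"
  have e: "e * b * (q - p) = 1" using det by (simp add: e_def field_simps)
  have "mul2 (mul2 P (p, 0, 0, q)) Q = (a, b, - cnj b, cnj a)"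
  proof -
    have "b * p * (e * (q - a)) + b * q * (e * (a - p)) = a * (e * b * (q - p))"
      "b * p * (- e * b) + b * q * (e * b) = b * (e * b * (q - p))"
      "(p - a) * p * (e * (q - a)) + (q - a) * q * (e * (a - p)) = e * (p - q) * ((p - a) * (q - a))"
      "(p - a) * p * (- e * b) + (q - a) * q * (e * b) = (p + q - a) * (e * b * (q - p))"
      by (simp_all add: algebra_simps)
    \<comment> \<open>The product \<open>(p - a) * (q - a)\<close> is the characteristic polynomial
      at \<open>a\<close>; trace \<open>a + cnj a\<close> and determinant 1 reduce it to
      \<open>b * cnj b\<close>.\<close>
    moreover have "e * (p - q) * ((p - a) * (q - a)) = - cnj b * (e * b * (q - p))"
    proof -
      have "(p - a) * (q - a) = p * q - a * (p + q) + a * a"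
      by (simp add: algebra_simps)
    also have "\<dots> = b * cnj b"
      unfolding pq(1,2) ab[symmetric] by (simp add: algebra_simps)
    finally show ?thesis by (simp add: algebra_simps)
    qed
    ultimately show ?thesis
      unfolding P_def Q_def mul2.simps e pq(2) by simp
  qed
  moreover have "mul2 Q (mul2 P (p, 0, 0, q)) = (p, 0, 0, q)"
  proof -
    have "e * (q - a) * (b * p) + - e * b * ((p - a) * p) = p * (e * b * (q - p))"
      "e * (q - a) * (b * q) + - e * b * ((q - a) * q) = 0"
      "e * (a - p) * (b * p) + e * b * ((p - a) * p) = 0"
      "e * (a - p) * (b * q) + e * b * ((q - a) * q) = q * (e * b * (q - p))"
      by (simp_all add: algebra_simps)
    then show ?thesis
      unfolding P_def Q_def mul2.simps e by simp
  qed
  ultimately have "sym_trace n (a, b, - cnj b, cnj a) = sym_trace n (p, 0, 0, q)"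
    using sym_trace_mul2_commute[of n "mul2 P (p, 0, 0, q)" Q] by simp
  also have "\<dots> = of_real (chebU n (Re a))"
    unfolding sym_trace_diag by (rule sum_powers_eq_chebU) (use pq in auto)
  finally show ?thesis .
qed

text \<open>The embedding of the quaternions: \<open>quat_mat x\<close> times the adjoint of \<open>quat_mat y\<close> has trace \<open>2 (x \<bullet> y)\<close>.\<close>

definition quat_mat :: "real ^ 4 \<Rightarrow> mat2" where
  "quat_mat x = (Complex (x $ 1) (x $ 2), Complex (x $ 3) (x $ 4), - cnj (Complex (x $ 3) (x $ 4)), cnj (Complex (x $ 1) (x $ 2)))"

lemma quaternion_mult:
  "mul2 (p, q, - cnj q, cnj p) (adj2 (r, s, - cnj s, cnj r))
    = (p * cnj r + q * cnj s, q * r - p * s, - cnj (q * r - p * s), cnj (p * cnj r + q * cnj s))"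
  by (simp add: algebra_simps)

lemma chebU_inner_eq_sym_trace:
  assumes "norm x = 1" "norm y = 1"
  shows "of_real (chebU n (x \<bullet> y)) = sym_trace n (mul2 (quat_mat x) (adj2 (quat_mat y)))"
proof -
  define a b where "a = Complex (x $ 1) (x $ 2) * cnj (Complex (y $ 1) (y $ 2)) + Complex (x $ 3) (x $ 4) * cnj (Complex (y $ 3) (y $ 4))"
    and "b = Complex (x $ 3) (x $ 4) * Complex (y $ 1) (y $ 2) - Complex (x $ 1) (x $ 2) * Complex (y $ 3) (y $ 4)"
  have *: "(z $ 1)\<^sup>2 + (z $ 2)\<^sup>2 + (z $ 3)\<^sup>2 + (z $ 4)\<^sup>2 = 1" if "norm z = 1" for z :: "real ^ 4"
    using that unfolding norm_eq_1 by (simp add: inner_vec_def sum_4 power2_eq_square)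
  \<comment> \<open>Euler's four-square identity: the quaternion norm is multiplicative.\<close>
  have "(cmod a)\<^sup>2 + (cmod b)\<^sup>2 = ((x $ 1)\<^sup>2 + (x $ 2)\<^sup>2 + (x $ 3)\<^sup>2 + (x $ 4)\<^sup>2) * ((y $ 1)\<^sup>2 + (y $ 2)\<^sup>2 + (y $ 3)\<^sup>2 + (y $ 4)\<^sup>2)"
    unfolding cmod_power2 by (simp add: a_def b_def power2_eq_square algebra_simps)
  also have "\<dots> = 1" using *[OF assms(1)] *[OF assms(2)] by simp
  finally have "(cmod a)\<^sup>2 + (cmod b)\<^sup>2 = 1" .
  from sym_trace_SU2[OF this]
  have "sym_trace n (a, b, - cnj b, cnj a) = of_real (chebU n (Re a))" .
  moreover have "Re a = x \<bullet> y"
    by (simp add: a_def inner_vec_def sum_4 algebra_simps)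
  moreover have "mul2 (quat_mat x) (adj2 (quat_mat y)) = (a, b, - cnj b, cnj a)"
    unfolding quat_mat_def a_def b_def by (rule quaternion_mult)
  ultimately show ?thesis by simp
qed

section \<open>Positive definiteness of the zonal kernels\<close>

text \<open>The trace of a product of symmetric powers is a sum of products of matrix entries, and
  \<open>sym_pow_adj2\<close> turns the second factor into a conjugate. The ratio of binomials in
  \<open>w\<close> arises there, because the monomial basis is orthogonal but not
  normalized.\<close>

lemma chebU_inner_feature_map:
  obtains w :: "nat \<Rightarrow> nat \<Rightarrow> real" and F :: "nat \<Rightarrow> nat \<Rightarrow> real ^ 4 \<Rightarrow> complex"
  where "\<And>k l. k \<le> n \<Longrightarrow> l \<le> n \<Longrightarrow> w k l > 0"
    and "\<And>x y. norm x = 1 \<Longrightarrow> norm y = 1 \<Longrightarrow>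
      of_real (chebU n (x \<bullet> y)) = (\<Sum>k\<le>n. \<Sum>l\<le>n. of_real (w k l) * F k l x * cnj (F k l y))"
proof -
  define w where "w k l = real (n choose k) / real (n choose l)" for k l
  define F where "F k l x = sym_pow n (quat_mat x) k l" for k l x
  have w: "w k l > 0" if "k \<le> n" "l \<le> n" for k l using that by (simp add: w_def)
  have F: "of_real (chebU n (x \<bullet> y)) = (\<Sum>k\<le>n. \<Sum>l\<le>n. of_real (w k l) * F k l x * cnj (F k l y))"
    if xy: "norm x = 1" "norm y = 1" for x y
  proof -
    have "sym_pow n (adj2 (quat_mat y)) l k = of_real (w k l) * cnj (F k l y)" if "k \<le> n" "l \<le> n" for k l
    proof -
      have "of_nat (n choose l) \<noteq> (0::complex)" using that by simp
      with sym_pow_adj2[OF that, of "quat_mat y"] show ?thesis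
        by (simp add: w_def F_def field_simps)
    qed
    then show ?thesis
      unfolding chebU_inner_eq_sym_trace[OF xy] sym_trace_def
      by (intro sum.cong) (auto simp: sym_pow_mul2 F_def mult_ac intro!: sum.cong)
  qed
  show thesis by (rule that[of w F]) (use w F in auto)
qed

text \<open>With \<open>S k l\<close> the weighted sums of features, \<open>Q\<close> is a
  positively weighted sum of the squares \<open>(cmod (S k l))\<^sup>2\<close>. If it vanishes, so
  does every \<open>S k l\<close>, and with them the linear form at every point of the
  sphere.\<close>

lemma chebU_inner_quadratic_form:
  fixes X :: "(real ^ 4) set" and c :: "real ^ 4 \<Rightarrow> real" and n :: nat
  assumes "X \<subseteq> sphere 0 1"
  defines "Q \<equiv> \<Sum>x\<in>X. \<Sum>y\<in>X. c x * c y * chebU n (x \<bullet> y)"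
  shows "Q \<ge> 0"
    and "Q = 0 \<Longrightarrow> y \<in> sphere 0 1 \<Longrightarrow> (\<Sum>x\<in>X. c x * chebU n (x \<bullet> y)) = 0"
proof -
  obtain w :: "nat \<Rightarrow> nat \<Rightarrow> real" and F :: "nat \<Rightarrow> nat \<Rightarrow> real ^ 4 \<Rightarrow> complex"
    where w: "\<And>k l. k \<le> n \<Longrightarrow> l \<le> n \<Longrightarrow> w k l > 0"
    and F: "\<And>x y. norm x = 1 \<Longrightarrow> norm y = 1 \<Longrightarrow>
      of_real (chebU n (x \<bullet> y)) = (\<Sum>k\<le>n. \<Sum>l\<le>n. of_real (w k l) * F k l x * cnj (F k l y))"
    by (rule chebU_inner_feature_map[of n]) (rule that)
  have norm1: "norm x = 1" if "x \<in> X" for x using that assms by auto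
  define S where "S k l = (\<Sum>x\<in>X. of_real (c x) * F k l x)" for k l
  have row: "of_real (\<Sum>x\<in>X. c x * chebU n (x \<bullet> y)) = (\<Sum>k\<le>n. \<Sum>l\<le>n. of_real (w k l) * S k l * cnj (F k l y))"
    if "norm y = 1" for y
  proof -
    have "of_real (\<Sum>x\<in>X. c x * chebU n (x \<bullet> y))
      = (\<Sum>x\<in>X. \<Sum>k\<le>n. \<Sum>l\<le>n. of_real (w k l) * (of_real (c x) * F k l x) * cnj (F k l y))"
      using that norm1 by (simp add: F sum_distrib_left mult_ac)
    also have "\<dots> = (\<Sum>k\<le>n. \<Sum>x\<in>X. \<Sum>l\<le>n. of_real (w k l) * (of_real (c x) * F k l x) * cnj (F k l y))"
      by (rule sum.swap)
    also have "\<dots> = (\<Sum>k\<le>n. \<Sum>l\<le>n. \<Sum>x\<in>X. of_real (w k l) * (of_real (c x) * F k l x) * cnj (F k l y))"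
      by (intro sum.cong sum.swap refl)
    finally show ?thesis by (simp add: S_def sum_distrib_left sum_distrib_right)
  qed
  have "complex_of_real Q = (\<Sum>y\<in>X. of_real (c y) * of_real (\<Sum>x\<in>X. c x * chebU n (x \<bullet> y)))"
    unfolding Q_def by (subst sum.swap) (simp add: sum_distrib_left mult_ac)
  also have "\<dots> = (\<Sum>y\<in>X. \<Sum>k\<le>n. \<Sum>l\<le>n. of_real (w k l) * S k l * cnj (of_real (c y) * F k l y))"
  proof (intro sum.cong refl)
    fix y assume "y \<in> X"
    show "of_real (c y) * of_real (\<Sum>x\<in>X. c x * chebU n (x \<bullet> y))
      = (\<Sum>k\<le>n. \<Sum>l\<le>n. of_real (w k l) * S k l * cnj (of_real (c y) * F k l y))"
      unfolding row[OF norm1[OF \<open>y \<in> X\<close>]] by (simp add: sum_distrib_left mult_ac)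
  qed
  also have "\<dots> = (\<Sum>k\<le>n. \<Sum>y\<in>X. \<Sum>l\<le>n. of_real (w k l) * S k l * cnj (of_real (c y) * F k l y))"
    by (rule sum.swap)
  also have "\<dots> = (\<Sum>k\<le>n. \<Sum>l\<le>n. \<Sum>y\<in>X. of_real (w k l) * S k l * cnj (of_real (c y) * F k l y))"
    by (intro sum.cong sum.swap refl)
  also have "\<dots> = (\<Sum>k\<le>n. \<Sum>l\<le>n. of_real (w k l) * S k l * cnj (S k l))"
    by (simp only: S_def cnj_sum sum_distrib_left)
  also have "\<dots> = of_real (\<Sum>k\<le>n. \<Sum>l\<le>n. w k l * (cmod (S k l))\<^sup>2)"
    by (simp add: complex_norm_square[symmetric] mult.assoc)
  finally have Q: "Q = (\<Sum>k\<le>n. \<Sum>l\<le>n. w k l * (cmod (S k l))\<^sup>2)"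
    by (simp only: of_real_eq_iff)
  have nonneg: "w k l * (cmod (S k l))\<^sup>2 \<ge> 0" if "k \<le> n" "l \<le> n" for k l
    using w[OF that] by simp
  show "Q \<ge> 0" unfolding Q by (intro sum_nonneg nonneg) auto
  assume "Q = 0" and y: "y \<in> sphere 0 1"
  then have row0: "\<forall>k\<in>{..n}. (\<Sum>l\<le>n. w k l * (cmod (S k l))\<^sup>2) = 0"
    unfolding Q by (subst (asm) sum_nonneg_eq_0_iff) (auto intro!: sum_nonneg nonneg)
  have wS0: "w k l * (cmod (S k l))\<^sup>2 = 0" if "k \<le> n" "l \<le> n" for k l
    using row0 that nonneg sum_nonneg_eq_0_iff[of "{..n}" "\<lambda>l. w k l * (cmod (S k l))\<^sup>2"] by auto
  have S0: "S k l = 0" if "k \<le> n" "l \<le> n" for k l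
    using wS0[OF that] w[OF that] by simp
  have "norm y = 1" using y by simp
  have "complex_of_real (\<Sum>x\<in>X. c x * chebU n (x \<bullet> y)) = 0"
    unfolding row[OF \<open>norm y = 1\<close>] by (intro sum.neutral ballI) (simp add: S0)
  then show "(\<Sum>x\<in>X. c x * chebU n (x \<bullet> y)) = 0"
    by (simp only: of_real_eq_0_iff)
qed

subsection \<open>Positive definite kernels\<close>

text \<open>Finite sets with coefficient functions, rather than enumerations of distinct points,
  make product grids and injective images plain reindexings.\<close>

definition pd_kernel :: "('a \<Rightarrow> 'a \<Rightarrow> real) \<Rightarrow> bool" where
  "pd_kernel K \<longleftrightarrow> (\<forall>A c. finite A \<longrightarrow> (\<Sum>x\<in>A. \<Sum>y\<in>A. c x * c y * K x y) \<ge> 0)"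

lemma pd_kernelI: "(\<And>A c. finite A \<Longrightarrow> (\<Sum>x\<in>A. \<Sum>y\<in>A. c x * c y * K x y) \<ge> 0) \<Longrightarrow> pd_kernel K"
  by (simp add: pd_kernel_def)

lemma pd_kernelD: "pd_kernel K \<Longrightarrow> finite A \<Longrightarrow> (\<Sum>x\<in>A. \<Sum>y\<in>A. c x * c y * K x y) \<ge> 0"
  by (simp add: pd_kernel_def)

lemma pd_kernel_if_pos_def_on_UNIV:
  assumes "pos_def_on UNIV K"
  shows "pd_kernel K"
proof (rule pd_kernelI)
  fix A :: "'a set" and c
  assume "finite A"
  then obtain x where x: "bij_betw x {1..card A} A" using ex_bij_betw_nat_finite_1 by blast
  have "(\<Sum>a\<in>A. \<Sum>b\<in>A. c a * c b * K a b) = (\<Sum>i=1..card A. \<Sum>j=1..card A. c (x i) * c (x j) * K (x i) (x j))"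
    by (simp add: sum.reindex_bij_betw[OF x, symmetric])
  also have "\<dots> \<ge> 0"
    using assms bij_betw_imp_inj_on[OF x] by (auto simp: pos_def_on_def)
  finally show "(\<Sum>a\<in>A. \<Sum>b\<in>A. c a * c b * K a b) \<ge> 0" .
qed

lemma pd_kernel_inj_compose:
  fixes f :: "'a \<Rightarrow> 'b"
  assumes "pd_kernel K" "inj f"
  shows "pd_kernel (\<lambda>x y. K (f x) (f y))"
proof (rule pd_kernelI)
  fix A :: "'a set" and c :: "'a \<Rightarrow> real"
  assume "finite A"
  have inj: "inj_on f A" using assms(2) by (rule inj_on_subset) simp
  have "(\<Sum>x\<in>f ` A. \<Sum>y\<in>f ` A. c (inv f x) * c (inv f y) * K x y) \<ge> 0"
    using assms(1) \<open>finite A\<close> by (intro pd_kernelD) auto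
  then show "(\<Sum>x\<in>A. \<Sum>y\<in>A. c x * c y * K (f x) (f y)) \<ge> 0"
    by (simp add: sum.reindex[OF inj] inv_f_f[OF assms(2)])
qed

section \<open>Integrating out a variable of a positive definite kernel\<close>

text \<open>Right endpoints leave out the node 0, as in the one-sided sums of a Toeplitz row. Each
  cell of width \<open>h\<close> contributes an error of at most \<open>h * q\<close>, and
  \<open>q\<close> is chosen so that the total is \<open>r / 2\<close>.\<close>

lemma riemann_sum_right:
  fixes e :: "real \<Rightarrow> real"
  assumes cont: "continuous_on {0..M} e" and M: "M > 0"
  shows "(\<lambda>N. M / real (Suc N) * (\<Sum>m=1..Suc N. e (M / real (Suc N) * real m))) \<longlonglongrightarrow> integral {0..M} e"
proof (rule LIMSEQ_I)
  fix r :: real assume "r > 0"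
  have "uniformly_continuous_on {0..M} e" using cont by (intro compact_uniformly_continuous) auto
  moreover define q where "q = r / (2 * M)"
  have "q > 0" using \<open>r > 0\<close> M by (simp add: q_def)
  with calculation obtain d where d: "d > 0" "\<And>x y. x \<in> {0..M} \<Longrightarrow> y \<in> {0..M} \<Longrightarrow> dist y x < d \<Longrightarrow> dist (e y) (e x) < q"
    unfolding uniformly_continuous_on_def by metis
  obtain N0 where N0: "M / d < real N0" using reals_Archimedean2 by blast
  show "\<exists>no. \<forall>N\<ge>no. norm (M / real (Suc N) * (\<Sum>m=1..Suc N. e (M / real (Suc N) * real m)) - integral {0..M} e) < r"
  proof (intro exI allI impI)
    fix N assume "N \<ge> N0"
    define h where "h = M / real (Suc N)"
    have h: "h > 0" "h * real (Suc N) = M" using M by (auto simp: h_def)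
    have "h < d"
    proof -
      have "M / d < real (Suc N)" using N0 \<open>N \<ge> N0\<close> by simp
      then show ?thesis using d(1) by (simp add: h_def field_simps)
    qed
    have "\<bar>h * (\<Sum>m=1..k. e (h * real m)) - integral {0..h * real k} e\<bar> \<le> real k * (h * q)"
      if "k \<le> Suc N" for k
      using that
    proof (induction k)
      case (Suc k)
      let ?a = "h * real k" and ?b = "h * real (Suc k)"
      have b: "?b \<le> M" using Suc.prems h(1) unfolding h(2)[symmetric] by (intro mult_left_mono) auto
      have a: "0 \<le> ?a" "?a \<le> ?b" using h(1) by auto
      have ce: "continuous_on {?a..?b} e"
        using cont by (rule continuous_on_subset) (use a b in auto)
      have "integral {0..?b} e = integral {0..?a} e + integral {?a..?b} e"
        using a b by (intro Henstock_Kurzweil_Integration.integral_combine[symmetric] integrable_continuous_real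
            continuous_on_subset[OF cont]) auto
      moreover have "\<bar>h * e ?b - integral {?a..?b} e\<bar> \<le> h * q"
      proof -
        have "integral {?a..?b} (\<lambda>x. e ?b - e x) = h * e ?b - integral {?a..?b} e"
          using ce by (subst integral_diff) (auto intro!: integrable_continuous_real simp: algebra_simps h(1) less_imp_le)
        moreover have "norm (integral {?a..?b} (\<lambda>x. e ?b - e x)) \<le> q * (?b - ?a)"
        proof (rule integral_bound)
          fix x assume x: "x \<in> {?a..?b}"
          have "dist ?b x < d" using x \<open>h < d\<close> by (auto simp: dist_real_def algebra_simps)
          then show "norm (e ?b - e x) \<le> q"
            using d(2)[of x ?b] x a b by (auto simp: dist_real_def less_imp_le)
        qed (use a ce in \<open>auto intro!: continuous_intros\<close>)
        ultimately show ?thesis by (simp add: algebra_simps)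
      qed
      ultimately show ?case using Suc by (simp add: algebra_simps abs_le_iff)
    qed simp
    from this[of "Suc N"] have "\<bar>h * (\<Sum>m=1..Suc N. e (h * real m)) - integral {0..M} e\<bar> \<le> M * q"
      by (simp only: h(2) mult.assoc[symmetric] mult.commute[of _ h])
    also have "\<dots> < r" using M \<open>r > 0\<close> by (simp add: q_def)
    finally show "norm (M / real (Suc N) * (\<Sum>m=1..Suc N. e (M / real (Suc N) * real m)) - integral {0..M} e) < r"
      by (simp add: h_def)
  qed
qed

text \<open>Beyond the support of \<open>e\<close> the Toeplitz sums grow linearly, with the total sum of \<open>e\<close> as slope; so
  their nonnegativity forces the total sum to be nonnegative.\<close>

lemma toeplitz_sum_Suc:
  fixes e :: "int \<Rightarrow> real"
  assumes even: "\<And>m. e (- m) = e m"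
  shows "(\<Sum>k<Suc L. \<Sum>l<Suc L. e (int k - int l))
    = (\<Sum>k<L. \<Sum>l<L. e (int k - int l)) + (e 0 + 2 * (\<Sum>m=1..L. e (int m)))"
proof -
  have row: "(\<Sum>l<L. e (int L - int l)) = (\<Sum>m=1..L. e (int m))"
    by (rule sum.reindex_bij_witness[of _ "\<lambda>m. L - m" "\<lambda>l. L - l"]) (auto simp: of_nat_diff)
  have "(\<Sum>k<L. e (int k - int L)) = (\<Sum>k<L. e (int L - int k))"
    by (intro sum.cong refl) (metis even minus_diff_eq)
  with row show ?thesis by (simp add: sum.distrib)
qed

lemma sum_nonneg_if_toeplitz_nonneg:
  fixes e :: "int \<Rightarrow> real"
  assumes even: "\<And>m. e (- m) = e m"
    and zero: "\<And>m. m > int N \<Longrightarrow> e m = 0"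
    and nonneg: "\<And>L. (\<Sum>k<L. \<Sum>l<L. e (int k - int l)) \<ge> 0"
  shows "e 0 + 2 * (\<Sum>m=1..N. e (int m)) \<ge> 0"
proof (rule ccontr)
  define S where "S = e 0 + 2 * (\<Sum>m=1..N. e (int m))"
  define T where "T L = (\<Sum>k<L. \<Sum>l<L. e (int k - int l))" for L
  assume "\<not> S \<ge> 0"
  have "T (N + j) = T N + real j * S" for j
  proof (induction j)
    case (Suc j)
    have "(\<Sum>m=1..N + j. e (int m)) = (\<Sum>m=1..N. e (int m))"
      by (rule sum.mono_neutral_right) (auto simp: zero)
    then show ?case
      using Suc toeplitz_sum_Suc[of e "N + j", OF even] by (simp add: T_def S_def algebra_simps)
  qed simp
  moreover obtain j where "T N / (- S) < real j" using reals_Archimedean2 by blast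
  then have "T N + real j * S < 0" using \<open>\<not> S \<ge> 0\<close> by (simp add: field_simps)
  ultimately show False using nonneg[of "N + j"] by (simp add: T_def)
qed

text \<open>Samples at mesh \<open>h = M / (N + 1)\<close> vanish beyond index \<open>N + 1\<close>,
  so the discrete result applies. Multiplied by \<open>h / 2\<close> it becomes a Riemann sum plus
  the diagonal term \<open>h / 2 * e 0\<close>, which disappears in the limit.\<close>

lemma integral_nonneg_if_toeplitz_nonneg:
  fixes e :: "real \<Rightarrow> real"
  assumes cont: "continuous_on {0..M} e" and M: "M > 0"
    and even: "\<And>s. e (- s) = e s" and zero: "\<And>s. s \<ge> M \<Longrightarrow> e s = 0"
    and nonneg: "\<And>h L. h > 0 \<Longrightarrow> (\<Sum>k<L. \<Sum>l<L. e (h * real k - h * real l)) \<ge> 0"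
  shows "integral {0..M} e \<ge> 0"
proof -
  have "(\<lambda>N. M / real (Suc N) * (\<Sum>m=1..Suc N. e (M / real (Suc N) * real m)) + M / 2 * e 0 * (1 / real (Suc N)))
    \<longlonglongrightarrow> integral {0..M} e + M / 2 * e 0 * 0"
    by (intro tendsto_add tendsto_mult tendsto_const riemann_sum_right cont M lim_1_over_n[THEN LIMSEQ_Suc])
  then have "(\<lambda>N. M / real (Suc N) * (\<Sum>m=1..Suc N. e (M / real (Suc N) * real m)) + M / 2 * e 0 * (1 / real (Suc N)))
    \<longlonglongrightarrow> integral {0..M} e" by simp
  then show ?thesis
  proof (rule LIMSEQ_le_const, intro exI allI impI)
    fix N
    define h where "h = M / real (Suc N)"
    have h: "h > 0" "h * real (Suc N) = M" using M by (auto simp: h_def)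
    have "e (h * of_int 0) + 2 * (\<Sum>m=1..Suc N. e (h * of_int (int m))) \<ge> 0"
    proof (rule sum_nonneg_if_toeplitz_nonneg[where e = "\<lambda>m. e (h * of_int m)"])
      fix m assume "m > int (Suc N)"
      then have "real (Suc N) \<le> of_int m" by linarith
      then have "h * real (Suc N) \<le> h * of_int m" using h(1) by (intro mult_left_mono) auto
      then show "e (h * of_int m) = 0" using zero h(2) by simp
    next
      fix L
      show "(\<Sum>k<L. \<Sum>l<L. e (h * of_int (int k - int l))) \<ge> 0"
        using nonneg[OF h(1), of L] by (simp add: algebra_simps)
    qed (use even in simp)
    moreover define S where "S = (\<Sum>m=1..Suc N. e (h * real m))"
    ultimately have "0 \<le> h / 2 * (e 0 + 2 * S)"
      using h(1) by (intro mult_nonneg_nonneg) auto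
    moreover have rescale: "M / 2 * e 0 * (1 / real (Suc N)) = h / 2 * e 0" by (simp add: h_def)
    ultimately show "0 \<le> M / real (Suc N) * (\<Sum>m=1..Suc N. e (M / real (Suc N) * real m)) + M / 2 * e 0 * (1 / real (Suc N))"
      unfolding rescale unfolding h_def[symmetric] S_def[symmetric] by (simp add: distrib_left)
  qed
qed

lemma sum_Times_Times:
  "(\<Sum>p\<in>I \<times> A. \<Sum>q\<in>I \<times> A. f p q) = (\<Sum>k\<in>I. \<Sum>l\<in>I. \<Sum>x\<in>A. \<Sum>y\<in>A. f (k, x) (l, y))"
  unfolding sum.cartesian_product' by (subst sum.swap[of _ A I]) (rule refl)

text \<open>Points are placed on a grid times \<open>A\<close>, with coefficients independent of the
  grid coordinate; the quadratic form is then a Toeplitz sum in that coordinate. By evenness the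
  half-line integral carries the sign of the full one.\<close>

lemma pd_kernel_integral:
  fixes K :: "real \<Rightarrow> 'a \<Rightarrow> 'a \<Rightarrow> real"
  assumes pd_kernel: "pd_kernel (\<lambda>p q. K (fst p - fst q) (snd p) (snd q))"
    and M: "M > 0"
    and cont: "\<And>x y. continuous_on {0..M} (\<lambda>s. K s x y)"
    and even: "\<And>s x y. K (- s) x y = K s x y"
    and zero: "\<And>s x y. s \<ge> M \<Longrightarrow> K s x y = 0"
  shows "pd_kernel (\<lambda>x y. integral {0..M} (\<lambda>s. K s x y))"
proof (rule pd_kernelI)
  fix A :: "'a set" and c :: "'a \<Rightarrow> real"
  assume "finite A"
  have "integral {0..M} (\<lambda>s. \<Sum>x\<in>A. \<Sum>y\<in>A. c x * c y * K s x y) \<ge> 0"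
  proof (rule integral_nonneg_if_toeplitz_nonneg[OF _ M])
    fix h :: real and L :: nat
    assume "h > 0"
    define I where "I = (\<lambda>k. h * real k) ` {..<L}"
    have inj: "inj_on (\<lambda>k. h * real k) {..<L}" using \<open>h > 0\<close> by (auto simp: inj_on_def)
    have "0 \<le> (\<Sum>p\<in>I \<times> A. \<Sum>q\<in>I \<times> A. c (snd p) * c (snd q) * K (fst p - fst q) (snd p) (snd q))"
      using \<open>finite A\<close> by (intro pd_kernelD[OF pd_kernel]) (simp add: I_def)
    also have "\<dots> = (\<Sum>k<L. \<Sum>l<L. \<Sum>x\<in>A. \<Sum>y\<in>A. c x * c y * K (h * real k - h * real l) x y)"
      unfolding sum_Times_Times by (simp add: I_def sum.reindex[OF inj])
    finally show "(\<Sum>k<L. \<Sum>l<L. \<Sum>x\<in>A. \<Sum>y\<in>A. c x * c y * K (h * real k - h * real l) x y) \<ge> 0" .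
  qed (use even zero in \<open>auto intro!: continuous_intros cont\<close>)
  also have "integral {0..M} (\<lambda>s. \<Sum>x\<in>A. \<Sum>y\<in>A. c x * c y * K s x y)
     = (\<Sum>x\<in>A. \<Sum>y\<in>A. c x * c y * integral {0..M} (\<lambda>s. K s x y))"
    using \<open>finite A\<close>
    by (subst integral_sum, auto intro!: integrable_continuous_real continuous_intros cont sum.cong)
       (subst integral_sum, auto intro!: integrable_continuous_real continuous_intros cont)
  finally show "(\<Sum>x\<in>A. \<Sum>y\<in>A. c x * c y * integral {0..M} (\<lambda>s. K s x y)) \<ge> 0" .
qed

text \<open>The easy half of Bochner's theorem. The real coefficients \<open>cos (u * s)\<close> and
  \<open>sin (u * s)\<close> stand for the two parts of a complex exponential, and their quadratic
  forms add up to the kernel times \<open>cos (u * (s - t))\<close>.\<close>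

lemma pd_kernel_cos_integral_nonneg:
  fixes k :: "real \<Rightarrow> real"
  assumes pd_kernel: "pd_kernel (\<lambda>s t. k (s - t))" and M: "M > 0"
    and cont: "continuous_on {0..M} k" and even: "\<And>s. k (- s) = k s"
    and zero: "\<And>s. s \<ge> M \<Longrightarrow> k s = 0"
  shows "integral {0..M} (\<lambda>s. cos (u * s) * k s) \<ge> 0"
proof (rule integral_nonneg_if_toeplitz_nonneg[OF _ M])
  fix h :: real and L :: nat
  assume "h > 0"
  define I where "I = (\<lambda>k. h * real k) ` {..<L}"
  have inj: "inj_on (\<lambda>k. h * real k) {..<L}" using \<open>h > 0\<close> by (auto simp: inj_on_def)
  have "0 \<le> (\<Sum>s\<in>I. \<Sum>t\<in>I. cos (u * s) * cos (u * t) * k (s - t)) + (\<Sum>s\<in>I. \<Sum>t\<in>I. sin (u * s) * sin (u * t) * k (s - t))"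
    by (intro add_nonneg_nonneg pd_kernelD[OF pd_kernel]) (simp_all add: I_def)
  also have "\<dots> = (\<Sum>s\<in>I. \<Sum>t\<in>I. cos (u * (s - t)) * k (s - t))"
    by (simp add: sum.distrib[symmetric] cos_diff right_diff_distrib distrib_right)
  also have "\<dots> = (\<Sum>i<L. \<Sum>j<L. cos (u * (h * real i - h * real j)) * k (h * real i - h * real j))"
    by (simp add: I_def sum.reindex[OF inj])
  finally show "(\<Sum>i<L. \<Sum>j<L. cos (u * (h * real i - h * real j)) * k (h * real i - h * real j)) \<ge> 0" .
qed (use even zero in \<open>auto intro!: continuous_intros cont\<close>)

subsection \<open>Radial functions on three-dimensional space\<close>

lemma integral_even:
  fixes e :: "real \<Rightarrow> real"
  assumes M: "M \<ge> 0" and cont: "continuous_on {-M..M} e" and even: "\<And>s. e (- s) = e s"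
  shows "integral {-M..M} e = 2 * integral {0..M} e"
proof -
  have "integral {-M..M} e = integral {-M..0} e + integral {0..M} e"
    using M cont by (intro Henstock_Kurzweil_Integration.integral_combine[symmetric] integrable_continuous_real) auto
  moreover have "integral {-M..0} e = integral {0..M} e"
    using Henstock_Kurzweil_Integration.integral_reflect_real[of M 0 e] by (simp add: even)
  ultimately show ?thesis by simp
qed

section \<open>Integrals of radial functions over a disc\<close>

text \<open>An annulus with squared radii \<open>x\<close> and \<open>M\<^sup>2\<close> has area
  \<open>pi * (M\<^sup>2 - x)\<close>, so the squared norm pushes area forward to a uniform measure.
  Half-lines \<open>{x<..}\<close> determine it; they cut out the whole disc, an annulus or
  nothing.\<close>

lemma distr_norm_power2_disc:
  fixes M :: real
  assumes M: "M \<ge> 0"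
  shows "distr (density lborel (\<lambda>w :: real \<times> real. ennreal (indicator (cball 0 M) w))) borel (\<lambda>w. (norm w)\<^sup>2)
    = density lborel (\<lambda>v. ennreal (pi * indicator {0..M\<^sup>2} v))" (is "?D = ?E")
proof -
  have disc: "emeasure lborel (cball (0 :: real \<times> real) r) = ennreal (pi * r\<^sup>2)" if "r \<ge> 0" for r
    using that by (simp add: emeasure_cball unit_ball_vol_2 power2_eq_square)
  have D: "emeasure ?D {x<..} = emeasure lborel (cball 0 M \<inter> {w :: real \<times> real. x < (norm w)\<^sup>2})" for x
  proof -
    have "emeasure ?D {x<..} = emeasure (density lborel (\<lambda>w :: real \<times> real. ennreal (indicator (cball 0 M) w))) {w. x < (norm w)\<^sup>2}"
      by (subst emeasure_distr) (auto simp: vimage_def)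
    also have "\<dots> = (\<integral>\<^sup>+ w. indicator (cball 0 M \<inter> {w :: real \<times> real. x < (norm w)\<^sup>2}) w \<partial>lborel)"
      by (subst emeasure_density) (auto intro!: nn_integral_cong simp: indicator_def simp del: nn_integral_indicator)
    also have "\<dots> = emeasure lborel (cball 0 M \<inter> {w :: real \<times> real. x < (norm w)\<^sup>2})"
      by (intro nn_integral_indicator) (auto simp: Int_def)
    finally show ?thesis .
  qed
  have E: "emeasure ?E {x<..} = ennreal pi * emeasure lborel ({x<..} \<inter> {0..M\<^sup>2})" for x
  proof -
    have "emeasure ?E {x<..} = (\<integral>\<^sup>+ v. ennreal pi * indicator ({x<..} \<inter> {0..M\<^sup>2}) v \<partial>lborel)"
      by (subst emeasure_density) (auto intro!: nn_integral_cong simp: indicator_def)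
    then show ?thesis by (simp add: nn_integral_cmult)
  qed
  have eq: "emeasure ?D {x<..} = emeasure ?E {x<..}" for x
  proof -
    consider "x < 0" | "0 \<le> x" "x \<le> M\<^sup>2" | "M\<^sup>2 < x" by linarith
    then show ?thesis
    proof cases
      case 1
      then have "cball 0 M \<inter> {w :: real \<times> real. x < (norm w)\<^sup>2} = cball 0 M" "{x<..} \<inter> {0..M\<^sup>2} = {0..M\<^sup>2}"
        using less_le_trans[OF 1 zero_le_power2] by auto
      then show ?thesis unfolding D E using M by (simp add: disc ennreal_mult)
    next
      case 2
      have "x < (norm w)\<^sup>2 \<longleftrightarrow> sqrt x < norm w" for w :: "real \<times> real"
        using real_sqrt_less_iff[of x "(norm w)\<^sup>2"] by simp
      then have "cball 0 M \<inter> {w :: real \<times> real. x < (norm w)\<^sup>2} = cball 0 M - cball 0 (sqrt x)"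
        by auto
      moreover have "{x<..} \<inter> {0..M\<^sup>2} = {x<..M\<^sup>2}"
        using 2 by auto
      moreover have "emeasure lborel (cball (0 :: real \<times> real) M - cball 0 (sqrt x)) = ennreal (pi * M\<^sup>2) - ennreal (pi * x)"
      proof -
        have "sqrt x \<le> M" using 2 M by (simp add: real_le_lsqrt)
        then show ?thesis using 2 M by (subst emeasure_Diff) (auto simp: disc)
      qed
      ultimately show ?thesis unfolding D E using M 2
        by (simp add: ennreal_mult[symmetric] ennreal_minus right_diff_distrib)
    next
      case 3
      have "(norm w)\<^sup>2 \<le> M\<^sup>2" if "norm w \<le> M" for w :: "real \<times> real"
        using that by (intro power_mono) auto
      with 3 have "cball 0 M \<inter> {w :: real \<times> real. x < (norm w)\<^sup>2} = {}" "{x<..} \<inter> {0..M\<^sup>2} = {}"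
        by force+
      then show ?thesis unfolding D E by simp
    qed
  qed
  show ?thesis
  proof (rule measure_eqI_lessThan)
    fix x
    have "emeasure lborel (cball 0 M \<inter> {w :: real \<times> real. x < (norm w)\<^sup>2}) \<le> emeasure lborel (cball (0 :: real \<times> real) M)"
      by (intro emeasure_mono) auto
    also have "\<dots> < \<infinity>" using M by (simp add: disc)
    finally show "emeasure ?D {x<..} < \<infinity>" unfolding D .
  qed (use eq in auto)
qed

lemma integral_disc_radial:
  fixes g :: "real \<Rightarrow> real"
  assumes M: "M \<ge> 0" and cont: "continuous_on UNIV g"
  shows "integral (cball (0 :: real \<times> real) M) (\<lambda>w. g ((norm w)\<^sup>2)) = pi * integral {0..M\<^sup>2} g"
proof -
  have [measurable]: "g \<in> borel_measurable borel"
    using cont by (rule borel_measurable_continuous_onI)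
  have "integral (cball (0 :: real \<times> real) M) (\<lambda>w. g ((norm w)\<^sup>2)) = (LINT w:cball (0 :: real \<times> real) M|lborel. g ((norm w)\<^sup>2))"
    unfolding set_lebesgue_integral_def
    by (rule set_borel_integral_eq_integral(2)[symmetric, unfolded set_lebesgue_integral_def set_integrable_def])
       (intro borel_integrable_compact continuous_on_compose2[OF cont] continuous_intros; simp)
  also have "\<dots> = (\<integral>w. g ((norm w)\<^sup>2) \<partial>density lborel (\<lambda>w :: real \<times> real. ennreal (indicator (cball 0 M) w)))"
    unfolding set_lebesgue_integral_def by (subst integral_density) (auto intro!: borel_measurable_indicator)
  also have "\<dots> = (\<integral>v. g v \<partial>distr (density lborel (\<lambda>w :: real \<times> real. ennreal (indicator (cball 0 M) w))) borel (\<lambda>w. (norm w)\<^sup>2))"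
    by (subst integral_distr) auto
  also have "\<dots> = (\<integral>v. (pi * indicator {0..M\<^sup>2} v) *\<^sub>R g v \<partial>lborel)"
    unfolding distr_norm_power2_disc[OF M] by (subst integral_density) auto
  also have "\<dots> = pi * (LINT v:{0..M\<^sup>2}|lborel. g v)"
    unfolding set_lebesgue_integral_def by (simp add: mult.assoc)
  also have "(LINT v:{0..M\<^sup>2}|lborel. g v) = integral {0..M\<^sup>2} g"
    by (rule set_borel_integral_eq_integral(2), unfold set_integrable_def,
        intro borel_integrable_compact continuous_on_subset[OF cont]) auto
  finally show ?thesis .
qed

text \<open>Integrating out coordinates one by one yields squares
  \<open>{0..M} \<times> {0..M}\<close>. Reflection in both axes gives a full square, hence the
  factor \<open>1 / 4\<close>, and \<open>g\<close> vanishes on the part outside the disc.\<close>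

lemma integral_quarter_square_radial:
  fixes g :: "real \<Rightarrow> real"
  assumes M: "M \<ge> 0" and cont: "continuous_on UNIV g" and zero: "\<And>v. v \<ge> M\<^sup>2 \<Longrightarrow> g v = 0"
  shows "integral {0..M} (\<lambda>x. integral {0..M} (\<lambda>y. g (x\<^sup>2 + y\<^sup>2))) = pi / 4 * integral {0..M\<^sup>2} g"
proof -
  have cont2: "continuous_on S (\<lambda>x. integral {-M..M} (\<lambda>y. g (x\<^sup>2 + y\<^sup>2)))" for S
  proof -
    have "continuous_on S (\<lambda>x. integral (cbox (-M) M) (\<lambda>y. g (x\<^sup>2 + y\<^sup>2)))"
      by (intro integral_continuous_on_param) (auto simp: split_beta intro!: continuous_on_compose2[OF cont] continuous_intros)
    then show ?thesis by simp
  qed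
  have "2 * (2 * integral {0..M} (\<lambda>x. integral {0..M} (\<lambda>y. g (x\<^sup>2 + y\<^sup>2))))
     = 2 * integral {0..M} (\<lambda>x. integral {-M..M} (\<lambda>y. g (x\<^sup>2 + y\<^sup>2)))"
    using M by (simp add: integral_even continuous_on_compose2[OF cont] continuous_intros)
  also have "\<dots> = integral {-M..M} (\<lambda>x. integral {-M..M} (\<lambda>y. g (x\<^sup>2 + y\<^sup>2)))"
    using M cont2 by (intro integral_even[symmetric]) auto
  also have "\<dots> = integral (cbox (-M, -M) (M, M)) (\<lambda>w. g ((norm w)\<^sup>2))"
    by (subst integral_prod_continuous) (auto simp: norm_Pair intro!: continuous_on_compose2[OF cont] continuous_intros)
  also have "\<dots> = integral (cbox (-M, -M) (M, M)) (\<lambda>w. if w \<in> cball 0 M then g ((norm w)\<^sup>2) else 0)"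
    using M by (intro integral_cong) (auto simp: zero not_le intro!: power_mono)
  also have "\<dots> = integral (cball (0 :: real \<times> real) M) (\<lambda>w. g ((norm w)\<^sup>2))"
  proof -
    have "cball 0 M \<inter> cbox (-M, -M) (M, M) = cball 0 M"
    proof (intro Int_absorb2 subsetI)
      fix w :: "real \<times> real" assume "w \<in> cball 0 M"
      then show "w \<in> cbox (-M, -M) (M, M)"
        using norm_fst_le[of "fst w" "snd w"] norm_snd_le[of "snd w" "fst w"]
        by (auto simp: cbox_Pair_eq mem_Times_iff abs_le_iff)
    qed
    then show ?thesis
      by (simp only: Henstock_Kurzweil_Integration.integral_restrict_Int)
  qed
  also have "\<dots> = pi * integral {0..M\<^sup>2} g"
    by (rule integral_disc_radial[OF M cont])
  finally show ?thesis by simp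
qed

section \<open>Projection of a radial kernel to a line\<close>

lemma continuous_on_radial:
  fixes \<phi> :: "real \<Rightarrow> real"
  assumes "continuous_on {0..} \<phi>" "continuous_on S f" "\<And>x. x \<in> S \<Longrightarrow> f x \<ge> 0"
  shows "continuous_on S (\<lambda>x. \<phi> (sqrt (f x)))"
  by (rule continuous_on_compose2[OF assms(1)]) (use assms(2,3) in \<open>auto intro: continuous_intros\<close>)

lemma pd_kernel_radial_section:
  fixes \<phi> :: "real \<Rightarrow> real"
  assumes pos: "pos_def_on (UNIV :: (real ^ 3) set) (\<lambda>x y. \<phi> (norm (x - y)))"
    and cont: "continuous_on {0..} \<phi>" and M: "M > 0" and zero: "\<And>t. t \<ge> M \<Longrightarrow> \<phi> t = 0"
  shows "pd_kernel (\<lambda>s t. integral {0..M} (\<lambda>x. integral {0..M} (\<lambda>y. \<phi> (sqrt ((s - t)\<^sup>2 + (x\<^sup>2 + y\<^sup>2))))))"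
proof -
  have zero': "\<phi> (sqrt v) = 0" if "v \<ge> M\<^sup>2" for v
    using that M by (intro zero) (auto intro: real_le_rsqrt)
  \<comment> \<open>Nested pairs put the coordinate to be integrated out first, as
    \<open>pd_kernel_integral\<close> expects, at both of its applications.\<close>
  define f :: "real \<times> real \<times> real \<Rightarrow> real ^ 3" where "f p = vector [fst p, fst (snd p), snd (snd p)]" for p
  have "inj f"
    by (auto simp: inj_def f_def vec_eq_iff forall_3)
  have norm_f: "norm (f p - f q) = sqrt ((snd (snd p) - snd (snd q))\<^sup>2 + ((fst (snd p) - fst (snd q))\<^sup>2 + (fst p - fst q)\<^sup>2))" for p q
    by (simp add: f_def norm_vec_def L2_set_def sum_3 algebra_simps)
  have "pd_kernel (\<lambda>p q. \<phi> (sqrt ((snd (snd p) - snd (snd q))\<^sup>2 + ((fst (snd p) - fst (snd q))\<^sup>2 + (fst p - fst q :: real)\<^sup>2))))"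
    using pd_kernel_inj_compose[OF pd_kernel_if_pos_def_on_UNIV[OF pos] \<open>inj f\<close>] by (simp add: norm_f)
  then have "pd_kernel (\<lambda>p q. integral {0..M} (\<lambda>y. \<phi> (sqrt ((snd p - snd q)\<^sup>2 + ((fst p - fst q :: real)\<^sup>2 + y\<^sup>2)))))"
    by (rule pd_kernel_integral[where K = "\<lambda>y p q. \<phi> (sqrt ((snd p - snd q)\<^sup>2 + ((fst p - fst q)\<^sup>2 + y\<^sup>2)))"])
      (use M in \<open>auto intro!: continuous_on_radial[OF cont] continuous_intros zero' add_increasing power_mono\<close>)
  then show ?thesis
  proof (rule pd_kernel_integral[where K = "\<lambda>x s t. integral {0..M} (\<lambda>y. \<phi> (sqrt ((s - t)\<^sup>2 + (x\<^sup>2 + y\<^sup>2))))", OF _ M])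
    fix s t :: real
    have "continuous_on {0..M} (\<lambda>x. integral (cbox 0 M) (\<lambda>y. \<phi> (sqrt ((s - t)\<^sup>2 + (x\<^sup>2 + y\<^sup>2)))))"
      by (intro integral_continuous_on_param) (auto simp: split_beta intro!: continuous_on_radial[OF cont] continuous_intros)
    then show "continuous_on {0..M} (\<lambda>x. integral {0..M} (\<lambda>y. \<phi> (sqrt ((s - t)\<^sup>2 + (x\<^sup>2 + y\<^sup>2)))))"
      by simp
  next
    fix x s t :: real
    assume "M \<le> x"
    then have "M\<^sup>2 \<le> (s - t)\<^sup>2 + (x\<^sup>2 + y\<^sup>2)" for y
      using M by (intro add_increasing add_increasing2 power_mono) auto
    then show "integral {0..M} (\<lambda>y. \<phi> (sqrt ((s - t)\<^sup>2 + (x\<^sup>2 + y\<^sup>2)))) = 0"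
      by (simp add: zero')
  qed simp
qed

text \<open>Over the plane at height \<open>s\<close> the squared radius is shifted by
  \<open>s\<^sup>2\<close>, so the integral is \<open>pi / 4\<close> times that of
  \<open>\<phi> (sqrt v)\<close> from \<open>s\<^sup>2\<close> to \<open>M\<^sup>2\<close>. This
  form is differentiable in \<open>s\<close> for merely continuous \<open>\<phi>\<close>.\<close>

lemma radial_section_eq:
  fixes \<phi> :: "real \<Rightarrow> real"
  assumes cont: "continuous_on {0..} \<phi>" and M: "M > 0" and zero: "\<And>t. t \<ge> M \<Longrightarrow> \<phi> t = 0"
    and s: "s \<in> {0..M}"
  shows "integral {0..M} (\<lambda>x. integral {0..M} (\<lambda>y. \<phi> (sqrt (s\<^sup>2 + (x\<^sup>2 + y\<^sup>2)))))
    = pi / 4 * (integral {0..M\<^sup>2} (\<lambda>v. \<phi> (sqrt v)) - integral {0..s\<^sup>2} (\<lambda>v. \<phi> (sqrt v)))"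
proof -
  have zero': "\<phi> (sqrt v) = 0" if "v \<ge> M\<^sup>2" for v
    using that M by (intro zero) (auto intro: real_le_rsqrt)
  have sM: "s\<^sup>2 \<le> M\<^sup>2" using s by (intro power_mono) auto
  have int: "(\<lambda>v. \<phi> (sqrt v)) integrable_on {a..b}" if "a \<ge> 0" for a b
    using that by (intro integrable_continuous_real continuous_on_radial[OF cont] continuous_intros) auto
  \<comment> \<open>The maximum extends the function continuously to negative \<open>v\<close>,
    since \<open>integral_quarter_square_radial\<close> asks for continuity on the whole
    line.\<close>
  define g where "g v = \<phi> (sqrt (s\<^sup>2 + max 0 v))" for v
  have "integral {0..M} (\<lambda>x. integral {0..M} (\<lambda>y. \<phi> (sqrt (s\<^sup>2 + (x\<^sup>2 + y\<^sup>2)))))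
      = integral {0..M} (\<lambda>x. integral {0..M} (\<lambda>y. g (x\<^sup>2 + y\<^sup>2)))"
    by (simp add: g_def)
  also have "\<dots> = pi / 4 * integral {0..M\<^sup>2} g"
  proof (rule integral_quarter_square_radial)
    show "continuous_on UNIV g"
      unfolding g_def by (intro continuous_on_radial[OF cont] continuous_intros) auto
    show "g v = 0" if "v \<ge> M\<^sup>2" for v
      using that unfolding g_def by (intro zero') (auto intro: add_increasing)
  qed (use M in simp)
  also have "integral {0..M\<^sup>2} g = integral {0..M\<^sup>2} ((\<lambda>v. \<phi> (sqrt v)) \<circ> (\<lambda>v. v + s\<^sup>2))"
    by (intro integral_cong) (simp add: g_def add.commute)
  also have "\<dots> = integral {0 + s\<^sup>2..M\<^sup>2 + s\<^sup>2} (\<lambda>v. \<phi> (sqrt v))"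
    by (rule integral_shift) (intro continuous_on_radial[OF cont] continuous_intros, auto intro: order.trans[of 0 "s\<^sup>2"])
  also have "\<dots> = integral {s\<^sup>2..M\<^sup>2} (\<lambda>v. \<phi> (sqrt v)) + integral {M\<^sup>2..M\<^sup>2 + s\<^sup>2} (\<lambda>v. \<phi> (sqrt v))"
    using sM int[of "s\<^sup>2"] by (simp add: Henstock_Kurzweil_Integration.integral_combine)
  also have "integral {M\<^sup>2..M\<^sup>2 + s\<^sup>2} (\<lambda>v. \<phi> (sqrt v)) = integral {M\<^sup>2..M\<^sup>2 + s\<^sup>2} (\<lambda>v. 0)"
    by (intro integral_cong) (simp add: zero')
  also have "integral {s\<^sup>2..M\<^sup>2} (\<lambda>v. \<phi> (sqrt v)) = integral {0..M\<^sup>2} (\<lambda>v. \<phi> (sqrt v)) - integral {0..s\<^sup>2} (\<lambda>v. \<phi> (sqrt v))"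
    using Henstock_Kurzweil_Integration.integral_combine[of 0 "s\<^sup>2" "M\<^sup>2", OF _ sM int[of 0]] by simp
  finally show ?thesis by simp
qed

lemma sine_transform_nonneg:
  fixes \<phi> :: "real \<Rightarrow> real"
  assumes pos: "pos_def_on (UNIV :: (real ^ 3) set) (\<lambda>x y. \<phi> (norm (x - y)))"
    and cont: "continuous_on {0..} \<phi>" and M: "M > 0" and zero: "\<And>t. t \<ge> M \<Longrightarrow> \<phi> t = 0"
    and u: "u \<ge> 0"
  shows "integral {0..M} (\<lambda>t. t * \<phi> t * sin (u * t)) \<ge> 0"
proof (cases "u = 0")
  case False
  define Q where "Q x = integral {0..x} (\<lambda>v. \<phi> (sqrt v))" for x
  define k where "k s = integral {0..M} (\<lambda>x. integral {0..M} (\<lambda>y. \<phi> (sqrt (s\<^sup>2 + (x\<^sup>2 + y\<^sup>2)))))" for s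
  have k_eq: "k s = pi / 4 * (Q (M\<^sup>2) - Q (s\<^sup>2))" if "s \<in> {0..M}" for s
    unfolding k_def Q_def by (rule radial_section_eq[OF cont M zero that])
  have zero': "\<phi> (sqrt v) = 0" if "v \<ge> M\<^sup>2" for v
    using that M by (intro zero) (auto intro: real_le_rsqrt)
  have deriv_Q: "(Q has_real_derivative \<phi> (sqrt x)) (at x within {0..M\<^sup>2})" if "x \<in> {0..M\<^sup>2}" for x
    unfolding Q_def using that
    by (intro integral_has_real_derivative continuous_on_radial[OF cont] continuous_intros) auto
  have sq: "(\<lambda>s. s\<^sup>2) ` {0..M} \<subseteq> {0..M\<^sup>2}" by (auto intro: power_mono)
  have deriv_Q2: "((\<lambda>s. Q (s\<^sup>2)) has_real_derivative \<phi> s * (2 * s)) (at s within {0..M})" if "s \<in> {0..M}" for s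
  proof -
    have "(Q \<circ> (\<lambda>s. s\<^sup>2) has_real_derivative \<phi> (sqrt (s\<^sup>2)) * (2 * s)) (at s within {0..M})"
    proof (rule DERIV_image_chain)
      show "(Q has_real_derivative \<phi> (sqrt (s\<^sup>2))) (at (s\<^sup>2) within (\<lambda>s. s\<^sup>2) ` {0..M})"
        using sq that by (intro has_field_derivative_subset[OF deriv_Q]) auto
    qed (auto intro!: derivative_eq_intros)
    then show ?thesis using that by (simp add: o_def)
  qed
  have cont_Q2: "continuous_on {0..M} (\<lambda>s. Q (s\<^sup>2))"
    by (rule DERIV_continuous_on[OF deriv_Q2])
  have cont_phi: "continuous_on {0..M} \<phi>" using cont by (rule continuous_on_subset) auto
  \<comment> \<open>Integration by parts with antiderivative
    \<open>sin (u * s) * (Q (M\<^sup>2) - Q (s\<^sup>2))\<close>; its second factor vanishes at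
    \<open>M\<close> and its first at 0.\<close>
  have "((\<lambda>s. u * (cos (u * s) * (Q (M\<^sup>2) - Q (s\<^sup>2))) - 2 * (s * \<phi> s * sin (u * s))) has_integral
      (sin (u * M) * (Q (M\<^sup>2) - Q (M\<^sup>2)) - sin (u * 0) * (Q (M\<^sup>2) - Q (0\<^sup>2)))) {0..M}"
  proof (rule fundamental_theorem_of_calculus)
    fix s assume s: "s \<in> {0..M}"
    have "((\<lambda>s. sin (u * s) * (Q (M\<^sup>2) - Q (s\<^sup>2))) has_real_derivative
        sin (u * s) * (0 - \<phi> s * (2 * s)) + cos (u * s) * u * (Q (M\<^sup>2) - Q (s\<^sup>2))) (at s within {0..M})"
      by (rule DERIV_mult'[OF _ DERIV_diff[OF DERIV_const deriv_Q2[OF s]]]) (auto intro!: derivative_eq_intros)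
    then show "((\<lambda>s. sin (u * s) * (Q (M\<^sup>2) - Q (s\<^sup>2))) has_vector_derivative
        u * (cos (u * s) * (Q (M\<^sup>2) - Q (s\<^sup>2))) - 2 * (s * \<phi> s * sin (u * s))) (at s within {0..M})"
      by (simp add: algebra_simps flip: has_real_derivative_iff_has_vector_derivative)
  qed (use M in simp)
  then have "integral {0..M} (\<lambda>s. u * (cos (u * s) * (Q (M\<^sup>2) - Q (s\<^sup>2))) - 2 * (s * \<phi> s * sin (u * s))) = 0"
    by (simp add: integral_unique)
  then have parts: "u * integral {0..M} (\<lambda>s. cos (u * s) * (Q (M\<^sup>2) - Q (s\<^sup>2)))
      = 2 * integral {0..M} (\<lambda>s. s * \<phi> s * sin (u * s))"
    by (subst (asm) integral_diff) (auto intro!: integrable_continuous_real continuous_intros cont_Q2 cont_phi)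
  have "0 \<le> integral {0..M} (\<lambda>s. cos (u * s) * k s)"
  proof (rule pd_kernel_cos_integral_nonneg[OF _ M])
    show "pd_kernel (\<lambda>s t. k (s - t))"
      unfolding k_def by (rule pd_kernel_radial_section[OF pos cont M zero])
    show "continuous_on {0..M} k"
      by (rule continuous_on_eq[OF _ k_eq[symmetric]]) (auto intro!: continuous_intros cont_Q2)
    fix s assume "s \<ge> M"
    then have "M\<^sup>2 \<le> s\<^sup>2 + (x\<^sup>2 + y\<^sup>2)" for x y
      using M by (intro add_increasing2 power_mono) auto
    then show "k s = 0" by (simp add: k_def zero')
  qed (simp add: k_def)
  also have "\<dots> = integral {0..M} (\<lambda>s. pi / 4 * (cos (u * s) * (Q (M\<^sup>2) - Q (s\<^sup>2))))"
    by (intro integral_cong) (simp add: k_eq)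
  finally have "0 \<le> integral {0..M} (\<lambda>s. cos (u * s) * (Q (M\<^sup>2) - Q (s\<^sup>2)))"
    by (simp add: zero_le_mult_iff) (use pi_gt_zero in linarith)
  then have "0 \<le> 2 * integral {0..M} (\<lambda>s. s * \<phi> s * sin (u * s))"
    unfolding parts[symmetric] using u by (intro mult_nonneg_nonneg)
  then show ?thesis by simp
qed simp

subsection \<open>Sine series\<close>

text \<open>Orthogonality to all \<open>sin x * U_n (cos x)\<close> is orthogonality to
  \<open>sin x * p (cos x)\<close> for every polynomial \<open>p\<close>. With \<open>p\<close>
  uniformly close to \<open>g \<circ> arccos\<close>, the integral of \<open>g\<^sup>2 * sin\<close>
  must vanish. The weight \<open>sin\<close> is zero at both endpoints, where continuity of
  \<open>g\<close> takes over.\<close>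

lemma sine_system_complete:
  fixes g :: "real \<Rightarrow> real"
  assumes cont: "continuous_on {0..pi} g"
    and orth: "\<And>n. integral {0..pi} (\<lambda>x. g x * sin (real (Suc n) * x)) = 0"
    and x: "x \<in> {0..pi}"
  shows "g x = 0"
proof -
  have orth_pow: "integral {0..pi} (\<lambda>x. g x * sin x * cos x ^ k) = 0" for k
  proof -
    obtain a N where a: "\<And>t. t ^ k = (\<Sum>n\<le>N. a n * chebU n t)"
      using power_eq_sum_chebU by blast
    have "integral {0..pi} (\<lambda>x. g x * sin x * cos x ^ k)
        = integral {0..pi} (\<lambda>x. \<Sum>n\<le>N. a n * (g x * sin (real (Suc n) * x)))"
      unfolding a sin_mult_chebU_cos[symmetric] by (intro integral_cong) (simp add: sum_distrib_left mult_ac)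
    also have "\<dots> = (\<Sum>n\<le>N. a n * integral {0..pi} (\<lambda>x. g x * sin (real (Suc n) * x)))"
      by (subst integral_sum) (auto intro!: integrable_continuous_real continuous_intros cont simp del: of_nat_Suc)
    also have "\<dots> = 0" unfolding orth by simp
    finally show ?thesis .
  qed
  have orth_poly: "integral {0..pi} (\<lambda>x. g x * sin x * p (cos x)) = 0" if p: "real_polynomial_function p" for p
  proof -
    obtain a N where a: "p = (\<lambda>t. \<Sum>i\<le>N. a i * t ^ i)"
      using p unfolding real_polynomial_function_iff_sum by blast
    have "integral {0..pi} (\<lambda>x. g x * sin x * p (cos x))
        = integral {0..pi} (\<lambda>x. \<Sum>i\<le>N. a i * (g x * sin x * cos x ^ i))"
      unfolding a by (intro integral_cong) (simp add: sum_distrib_left mult_ac)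
    also have "\<dots> = (\<Sum>i\<le>N. a i * integral {0..pi} (\<lambda>x. g x * sin x * cos x ^ i))"
      by (subst integral_sum) (auto intro!: integrable_continuous_real continuous_intros cont)
    also have "\<dots> = 0" unfolding orth_pow by simp
    finally show ?thesis .
  qed
  obtain B where B: "\<forall>x\<in>{0..pi}. \<bar>g x\<bar> \<le> B" "B > 0"
    using compact_imp_bounded[OF compact_continuous_image[OF cont compact_Icc]]
    by (auto simp: bounded_pos)
  define I where "I = integral {0..pi} (\<lambda>x. g x * g x * sin x)"
  have "I \<le> 0 + e" if "e > 0" for e
  proof -
    define d where "d = e / (B * pi)"
    have "d > 0" using that B by (simp add: d_def)
    have "continuous_on {-1..1} (\<lambda>t. g (arccos t))"
      by (rule continuous_on_compose2[OF cont continuous_on_arccos']) (auto simp: arccos_lbound arccos_ubound)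
    then obtain p where p: "real_polynomial_function p" "\<And>t. t \<in> {-1..1} \<Longrightarrow> \<bar>g (arccos t) - p t\<bar> < d"
      using Stone_Weierstrass_real_polynomial_function[of "{-1..1}" "\<lambda>t. g (arccos t)" d] \<open>d > 0\<close> by auto
    have cont_p: "continuous_on {0..pi} (\<lambda>x. p (cos x))"
    proof (rule continuous_on_compose2[of UNIV p])
      show "continuous_on UNIV p"
        using p(1) by (intro continuous_on_polymonial_function) (simp add: real_polynomial_function_eq)
    qed (auto intro!: continuous_intros)
    have "I = I - integral {0..pi} (\<lambda>x. g x * sin x * p (cos x))" by (simp add: orth_poly[OF p(1)])
    also have "\<dots> = integral {0..pi} (\<lambda>x. g x * g x * sin x - g x * sin x * p (cos x))"
      unfolding I_def by (intro integral_diff[symmetric] integrable_continuous_real continuous_intros cont cont_p)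
    also have "\<dots> \<le> integral {0..pi} (\<lambda>x. B * d)"
    proof (intro integral_le integrable_continuous_real continuous_intros cont cont_p)
      fix x assume x: "x \<in> {0..pi}"
      have "g x * g x * sin x - g x * sin x * p (cos x) = g x * ((g x - p (cos x)) * sin x)"
        by (simp add: algebra_simps)
      also have "\<dots> \<le> \<bar>g x\<bar> * (\<bar>g x - p (cos x)\<bar> * \<bar>sin x\<bar>)"
        unfolding abs_mult[symmetric] by (rule abs_ge_self)
      also have "\<dots> \<le> B * (d * 1)"
        using p(2)[of "cos x"] x B by (intro mult_mono) (auto simp: arccos_cos less_imp_le)
      finally show "g x * g x * sin x - g x * sin x * p (cos x) \<le> B * d" by simp
    qed
    also have "\<dots> = e" using B by (simp add: d_def)
    finally show ?thesis by simp
  qed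
  then have "I \<le> 0" by (rule field_le_epsilon)
  moreover have nonneg: "g x * g x * sin x \<ge> 0" if "x \<in> {0..pi}" for x
    using that sin_ge_zero[of x] by simp
  then have "I \<ge> 0" unfolding I_def
    by (intro integral_nonneg integrable_continuous_real continuous_intros cont)
  ultimately have "I = 0" by simp
  moreover have "continuous_on {0..pi} (\<lambda>x. g x * g x * sin x)"
    by (intro continuous_intros cont)
  ultimately have "\<forall>x\<in>{0..pi}. g x * g x * sin x = 0"
    using integral_eq_0_iff[of 0 pi "\<lambda>x. g x * g x * sin x"] nonneg
    by (simp add: I_def)
  then have zero: "g x = 0" if "x \<in> {0<..<pi}" for x
    using that sin_gt_zero[of x] by force
  show ?thesis
    by (rule continuous_constant_on_closure[of "{0<..<pi}" g]) (use cont zero x in auto)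
qed

section \<open>Differentiation and analytic continuation of the transforms\<close>

lemma cosine_transform_deriv:
  fixes \<phi> :: "real \<Rightarrow> real"
  assumes cont: "continuous_on {0..M} \<phi>"
  shows "((\<lambda>u. integral {0..M} (\<lambda>t. \<phi> t * cos (u * t))) has_real_derivative
     - integral {0..M} (\<lambda>t. t * \<phi> t * sin (u * t))) (at u)"
proof -
  have cont2: "continuous_on (UNIV \<times> {0..M}) (\<lambda>p. \<phi> (snd p))"
    by (rule continuous_on_compose2[OF cont]) (auto intro!: continuous_intros)
  have "((\<lambda>u. integral (cbox 0 M) (\<lambda>t. \<phi> t * cos (u * t))) has_real_derivative
     integral (cbox 0 M) (\<lambda>t. - (t * \<phi> t * sin (u * t)))) (at u within UNIV)"
    by (rule leibniz_rule_field_derivative)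
      (auto intro!: derivative_eq_intros integrable_continuous_real continuous_intros cont cont2 simp: split_beta)
  then show ?thesis by simp
qed

lemma sine_transform_eq_0_if_eq_0_on_interval:
  fixes \<phi> :: "real \<Rightarrow> real"
  assumes cont: "continuous_on {0..M} \<phi>" and ab: "a < b"
    and zero: "\<And>u. u \<in> {a<..<b} \<Longrightarrow> integral {0..M} (\<lambda>t. \<phi> t * sin (u * t)) = 0"
  shows "integral {0..M} (\<lambda>t. \<phi> t * sin (u * t)) = 0"
proof -
  define H where "H z = integral (cbox 0 M) (\<lambda>t. complex_of_real (\<phi> t) * sin (z * of_real t))" for z
  have H_of_real: "H (of_real u) = of_real (integral {0..M} (\<lambda>t. \<phi> t * sin (u * t)))" for u
  proof -
    have "(\<lambda>t. \<phi> t * sin (u * t)) integrable_on {0..M}"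
      by (intro integrable_continuous_real continuous_intros cont)
    then have "((\<lambda>t. complex_of_real (\<phi> t * sin (u * t))) has_integral of_real (integral {0..M} (\<lambda>t. \<phi> t * sin (u * t)))) {0..M}"
      by (intro has_integral_of_real integrable_integral)
    then show ?thesis by (simp add: H_def integral_unique sin_of_real flip: of_real_mult)
  qed
  have cont2: "continuous_on (UNIV \<times> {0..M}) (\<lambda>p :: complex \<times> real. \<phi> (snd p))"
    by (rule continuous_on_compose2[OF cont]) (auto intro!: continuous_intros)
  have "H holomorphic_on UNIV"
    unfolding H_def
    by (rule leibniz_rule_holomorphic[where fx = "\<lambda>z t. complex_of_real (\<phi> t) * (of_real t * cos (z * of_real t))"])
      (auto intro!: derivative_eq_intros integrable_continuous_real continuous_intros cont cont2 simp: split_beta)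
  \<comment> \<open>The identity theorem needs an accumulation point of zeros; the midpoint of the
    real interval is one.\<close>
  moreover have "complex_of_real ((a + b) / 2) islimpt of_real ` {a<..<b}"
  proof -
    have "(a + b) / 2 islimpt {a<..<b}" using ab by (auto simp: islimpt_greaterThanLessThan1 intro!: interior_limit_point)
    then show ?thesis
      unfolding islimpt_approachable by (metis dist_of_real imageI of_real_eq_iff)
  qed
  moreover have "H z = 0" if "z \<in> of_real ` {a<..<b}" for z
    using that zero by (auto simp: H_of_real)
  ultimately have "H (of_real u) = 0"
    using analytic_continuation[OF _ open_UNIV connected_UNIV subset_UNIV UNIV_I _ _ UNIV_I] by blast
  then show ?thesis by (simp add: H_of_real)
qed

section \<open>Trigonometric estimates and termwise integration\<close>

lemma sin_ge_half:
  fixes x :: real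
  assumes "0 \<le> x" "x \<le> 1"
  shows "sin x \<ge> x / 2"
proof -
  have "sin 0 - 0 / 2 \<le> sin x - x / 2"
  proof (rule DERIV_nonneg_imp_nondecreasing[OF assms(1)])
    fix y assume y: "0 \<le> y" "y \<le> x"
    have "cos y \<ge> cos (pi / 3)"
      using y assms pi_gt3 by (intro cos_monotone_0_pi_le) auto
    then have "cos y - 1 / 2 \<ge> 0" by (simp add: cos_60)
    then show "\<exists>D. ((\<lambda>x. sin x - x / 2) has_real_derivative D) (at y) \<and> 0 \<le> D"
      by (intro exI[of _ "cos y - 1 / 2"]) (auto intro!: derivative_eq_intros)
  qed
  then show ?thesis by simp
qed

text \<open>Serves to bound integrals of \<open>sin (real (Suc n) * x)\<close> over short intervals
  from below. The constant comes from \<open>2 * (x / 4)\<^sup>2\<close>, by the half-angle formula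
  and \<open>sin_ge_half\<close>.\<close>

lemma one_minus_cos_ge:
  fixes x :: real
  assumes "0 \<le> x" "x \<le> 1"
  shows "1 - cos x \<ge> x\<^sup>2 / 8"
proof -
  have "1 - cos x = 2 * (sin (x / 2))\<^sup>2"
    using cos_double_sin[of "x / 2"] by simp
  also have "\<dots> \<ge> 2 * (x / 2 / 2)\<^sup>2"
    using sin_ge_half[of "x / 2"] assms by (intro mult_left_mono power_mono) auto
  finally show ?thesis by (simp add: power2_eq_square)
qed

lemma integral_sin_mult_sin:
  "integral {0..pi} (\<lambda>x. sin (real (Suc m) * x) * sin (real (Suc n) * x)) = (if m = n then pi / 2 else 0)"
proof -
  have cos_int: "integral {0..pi} (\<lambda>x. cos (real_of_int k * x)) = (if k = 0 then pi else 0)" for k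
  proof -
    have "integral {-pi..pi} (\<lambda>x. cos (real_of_int k * x)) = 2 * integral {0..pi} (\<lambda>x. cos (real_of_int k * x))"
      by (rule integral_even) (auto intro!: continuous_intros)
    then show ?thesis
      using integral_cos_nx[of k] by (simp add: mult.commute split: if_splits)
  qed
  have "integral {0..pi} (\<lambda>x. sin (real (Suc m) * x) * sin (real (Suc n) * x))
     = integral {0..pi} (\<lambda>x. (cos (real_of_int (int m - int n) * x) - cos (real_of_int (int m + int n + 2) * x)) * (1 / 2))"
    by (intro integral_cong) (simp add: sin_times_sin algebra_simps diff_divide_distrib)
  also have "\<dots> = (integral {0..pi} (\<lambda>x. cos (real_of_int (int m - int n) * x)) - integral {0..pi} (\<lambda>x. cos (real_of_int (int m + int n + 2) * x))) * (1 / 2)"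
    by (subst integral_mult_left, subst integral_diff) (auto intro!: integrable_continuous_real continuous_intros)
  finally show ?thesis unfolding cos_int by auto
qed

text \<open>The weight \<open>w\<close> serves two purposes: a sine extracts a coefficient, and the
  constant 1 gives a plain integral over a short interval.\<close>

lemma sine_series_integral_sums:
  fixes b :: "nat \<Rightarrow> real"
  assumes b: "summable (\<lambda>n. \<bar>b n\<bar>)" and w: "continuous_on {c..d} w"
  shows "(\<lambda>n. b n * integral {c..d} (\<lambda>x. sin (real (Suc n) * x) * w x)) sums
    integral {c..d} (\<lambda>x. (\<Sum>n. b n * sin (real (Suc n) * x)) * w x)"
proof -
  obtain B where B: "\<forall>x\<in>{c..d}. \<bar>w x\<bar> \<le> B" "B > 0"
    using compact_imp_bounded[OF compact_continuous_image[OF w compact_Icc]]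
    by (auto simp: bounded_pos)
  have sum: "summable (\<lambda>n. b n * sin (real (Suc n) * x))" for x
    by (rule summable_comparison_test'[OF b, of 0]) (auto simp: abs_mult intro!: mult_left_le)
  have "uniform_limit {c..d} (\<lambda>n x. \<Sum>i<n. b i * (sin (real (Suc i) * x) * w x))
      (\<lambda>x. \<Sum>i. b i * (sin (real (Suc i) * x) * w x)) sequentially"
  proof (rule Weierstrass_m_test)
    show "summable (\<lambda>n. \<bar>b n\<bar> * B)" using b by (rule summable_mult2)
    show "norm (b n * (sin (real (Suc n) * x) * w x)) \<le> \<bar>b n\<bar> * B" if "x \<in> {c..d}" for n x
    proof -
      have "\<bar>sin (real (Suc n) * x)\<bar> * \<bar>w x\<bar> \<le> 1 * B"
        using B that by (intro mult_mono) auto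
      then show ?thesis by (simp add: abs_mult mult_left_mono del: of_nat_Suc)
    qed
  qed
  moreover have "(\<Sum>i. b i * (sin (real (Suc i) * x) * w x)) = (\<Sum>i. b i * sin (real (Suc i) * x)) * w x" for x
    using suminf_mult2[OF sum[of x], of "w x"] by (simp add: mult.assoc)
  ultimately have "uniform_limit {c..d} (\<lambda>n x. \<Sum>i<n. b i * (sin (real (Suc i) * x) * w x))
      (\<lambda>x. (\<Sum>i. b i * sin (real (Suc i) * x)) * w x) sequentially" by simp
  then obtain I J where I: "\<And>n. ((\<lambda>x. \<Sum>i<n. b i * (sin (real (Suc i) * x) * w x)) has_integral I n) {c..d}"
    and J: "((\<lambda>x. (\<Sum>i. b i * sin (real (Suc i) * x)) * w x) has_integral J) {c..d}" and lim: "I \<longlonglongrightarrow> J"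
    by (rule uniform_limit_integral) (auto intro!: continuous_intros w simp del: of_nat_Suc)
  have "I n = (\<Sum>i<n. b i * integral {c..d} (\<lambda>x. sin (real (Suc i) * x) * w x))" for n
    unfolding integral_unique[OF I, symmetric]
    by (subst integral_sum) (auto intro!: integrable_continuous_real continuous_intros w simp del: of_nat_Suc)
  then have "I = (\<lambda>n. \<Sum>i<n. b i * integral {c..d} (\<lambda>x. sin (real (Suc i) * x) * w x))" ..
  then show ?thesis using lim integral_unique[OF J] by (simp add: sums_def)
qed

lemma continuous_on_sine_series:
  fixes b :: "nat \<Rightarrow> real"
  assumes b: "summable (\<lambda>n. \<bar>b n\<bar>)"
  shows "continuous_on S (\<lambda>x. \<Sum>n. b n * sin (real (Suc n) * x))"
proof (rule uniform_limit_theorem)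
  show "uniform_limit S (\<lambda>n x. \<Sum>i<n. b i * sin (real (Suc i) * x)) (\<lambda>x. \<Sum>n. b n * sin (real (Suc n) * x)) sequentially"
    by (rule Weierstrass_m_test[OF _ b]) (auto simp: abs_mult intro!: mult_left_le)
qed (auto intro!: always_eventually continuous_intros)

subsection \<open>Expansion in Chebyshev polynomials\<close>

lemma cosine_transform_strict_decreasing:
  fixes \<phi> :: "real \<Rightarrow> real"
  assumes cont: "continuous_on {0..pi} \<phi>" and nz: "\<phi> 0 \<noteq> 0"
    and nonneg: "\<And>u. u \<ge> 0 \<Longrightarrow> integral {0..pi} (\<lambda>t. t * \<phi> t * sin (u * t)) \<ge> 0"
    and ab: "0 \<le> a" "a < b"
  shows "integral {0..pi} (\<lambda>t. \<phi> t * cos (b * t)) < integral {0..pi} (\<lambda>t. \<phi> t * cos (a * t))"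
proof -
  define f where "f u = integral {0..pi} (\<lambda>t. \<phi> t * cos (u * t))" for u
  define H where "H u = integral {0..pi} (\<lambda>t. t * \<phi> t * sin (u * t))" for u
  have deriv: "(f has_real_derivative - H u) (at u)" for u
    unfolding f_def H_def by (rule cosine_transform_deriv[OF cont])
  have antimono: "f v \<le> f u" if "0 \<le> u" "u \<le> v" for u v
    using that by (intro DERIV_nonpos_imp_nonincreasing[OF that(2)])
      (use deriv nonneg in \<open>force simp: H_def\<close>)
  \<comment> \<open>Equality would make the monotone \<open>f\<close> constant on the interval, so
    \<open>H\<close> vanishes there and, by continuation, everywhere. Completeness of the sines then
    kills \<open>t * \<phi> t\<close>, contradicting \<open>\<phi> 0 \<noteq> 0\<close>.\<close>
  have "f b \<noteq> f a"
  proof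
    assume "f b = f a"
    then have const: "f u = f a" if "u \<in> {a<..<b}" for u
      using antimono[of a u] antimono[of u b] that ab by simp
    have H0: "H u = 0" if u: "u \<in> {a<..<b}" for u
    proof -
      have "(f has_real_derivative 0) (at u)"
        by (rule has_field_derivative_transform_within_open[of "\<lambda>_. f a" 0 u "{a<..<b}"])
           (use u const in auto)
      then show ?thesis using DERIV_unique[OF deriv] by force
    qed
    have cont_t: "continuous_on {0..pi} (\<lambda>t. t * \<phi> t)"
      by (intro continuous_intros cont)
    have "integral {0..pi} (\<lambda>t. t * \<phi> t * sin (u * t)) = 0" for u
      by (rule sine_transform_eq_0_if_eq_0_on_interval[OF cont_t ab(2) H0[unfolded H_def]])
    then have t_phi: "t * \<phi> t = 0" if "t \<in> {0..pi}" for t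
      using sine_system_complete[OF cont_t _ that] by blast
    have phi0: "\<phi> t = 0" if "t \<in> {0<..<pi}" for t
      using t_phi[of t] that by simp
    have "\<phi> 0 = 0"
      by (rule continuous_constant_on_closure[of "{0<..<pi}" \<phi>]) (use cont phi0 in auto)
    with nz show False by simp
  qed
  then show ?thesis
    using antimono[of a b] ab by (simp add: f_def)
qed

lemma sine_coefficient_eq:
  fixes \<phi> :: "real \<Rightarrow> real"
  assumes cont: "continuous_on {0..pi} \<phi>"
  shows "integral {0..pi} (\<lambda>t. \<phi> t * sin t * sin (real (Suc n) * t))
    = (integral {0..pi} (\<lambda>t. \<phi> t * cos (real n * t)) - integral {0..pi} (\<lambda>t. \<phi> t * cos (real (n + 2) * t))) / 2"
proof -
  have "integral {0..pi} (\<lambda>t. \<phi> t * sin t * sin (real (Suc n) * t))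
     = integral {0..pi} (\<lambda>t. (\<phi> t * cos (real n * t) - \<phi> t * cos (real (n + 2) * t)) / 2)"
  proof (rule integral_cong)
    fix t
    have eqs: "cos (real n * t) = cos (real (Suc n) * t - t)" "cos (real (n + 2) * t) = cos (real (Suc n) * t + t)"
      by (simp_all add: algebra_simps)
    show "\<phi> t * sin t * sin (real (Suc n) * t) = (\<phi> t * cos (real n * t) - \<phi> t * cos (real (n + 2) * t)) / 2"
      unfolding eqs cos_add cos_diff by (simp add: algebra_simps del: of_nat_Suc)
  qed
  also have "\<dots> = (integral {0..pi} (\<lambda>t. \<phi> t * cos (real n * t)) - integral {0..pi} (\<lambda>t. \<phi> t * cos (real (n + 2) * t))) / 2"
    by (simp add: integral_diff integrable_continuous_real continuous_intros cont)
  finally show ?thesis .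
qed

lemma sum_telescope_2:
  fixes f :: "nat \<Rightarrow> real"
  shows "(\<Sum>n<N. f n - f (n + 2)) = f 0 + f 1 - f N - f (N + 1)"
  by (induction N) auto

text \<open>The identity is proved for \<open>\<phi> t * sin t\<close> first, whose sine
  coefficients are absolutely summable because they are positive and telescope. Undoing the factor
  \<open>sin t\<close> requires the stronger summability \<open>nb\<close>.\<close>

lemma chebU_expansion:
  fixes \<phi> :: "real \<Rightarrow> real"
  assumes cont: "continuous_on {0..pi} \<phi>" and nz: "\<phi> 0 \<noteq> 0"
    and nonneg: "\<And>u. u \<ge> 0 \<Longrightarrow> integral {0..pi} (\<lambda>t. t * \<phi> t * sin (u * t)) \<ge> 0"
  obtains b where "\<And>n. b n > 0"
    and "\<And>t. t \<in> {0..pi} \<Longrightarrow> (\<lambda>n. b n * chebU n (cos t)) sums \<phi> t"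
proof -
  obtain B where B: "\<forall>x\<in>{0..pi}. \<bar>\<phi> x\<bar> \<le> B" "B > 0"
    using compact_imp_bounded[OF compact_continuous_image[OF cont compact_Icc]]
    by (auto simp: bounded_pos)
  define f where "f n = integral {0..pi} (\<lambda>t. \<phi> t * cos (real n * t))" for n
  \<comment> \<open>The integral of \<open>\<phi> t * sin t\<close> against the sine of frequency
    \<open>n + 1\<close> is \<open>(f n - f (n + 2)) / 2\<close>; dividing by the square norm
    \<open>pi / 2\<close> gives \<open>b n\<close>.\<close>
  define b where "b n = (f n - f (n + 2)) / pi" for n
  have pos: "b n > 0" for n
    using cosine_transform_strict_decreasing[OF cont nz nonneg, of "real n" "real (n + 2)"]
    by (simp add: b_def f_def)
  have f_bound: "\<bar>f n\<bar> \<le> B * pi" for n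
  proof -
    have "norm (f n) \<le> B * (pi - 0)"
      unfolding f_def
    proof (rule integral_bound)
      fix t assume "t \<in> {0..pi}"
      then have "\<bar>\<phi> t\<bar> * \<bar>cos (real n * t)\<bar> \<le> B * 1" using B by (intro mult_mono) auto
      then show "norm (\<phi> t * cos (real n * t)) \<le> B" by (simp add: abs_mult)
    qed (auto intro!: continuous_intros cont)
    then show ?thesis by simp
  qed
  have "summable b"
  proof (rule summableI_nonneg_bounded)
    fix N
    have "(\<Sum>n<N. b n) = (f 0 + f 1 - f N - f (N + 1)) / pi"
      unfolding b_def sum_divide_distrib[symmetric] sum_telescope_2 ..
    also have "\<dots> \<le> (4 * (B * pi)) / pi"
      using f_bound[of 0] f_bound[of 1] f_bound[of N] f_bound[of "N + 1"] by (intro divide_right_mono) auto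
    finally show "(\<Sum>n<N. b n) \<le> (4 * (B * pi)) / pi" .
  qed (use pos in \<open>simp add: less_imp_le\<close>)
  then have b_abs: "summable (\<lambda>n. \<bar>b n\<bar>)" using pos by (simp add: less_imp_le)
  define S where "S x = (\<Sum>n. b n * sin (real (Suc n) * x))" for x
  have cont_S: "continuous_on A S" for A
    unfolding S_def by (rule continuous_on_sine_series[OF b_abs])
  have S_coeff: "integral {0..pi} (\<lambda>x. S x * sin (real (Suc n) * x)) = b n * (pi / 2)" for n
  proof -
    have "(\<lambda>m. b m * integral {0..pi} (\<lambda>x. sin (real (Suc m) * x) * sin (real (Suc n) * x))) sums
        integral {0..pi} (\<lambda>x. S x * sin (real (Suc n) * x))"
      unfolding S_def by (rule sine_series_integral_sums[OF b_abs]) (intro continuous_intros)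
    moreover have "(\<lambda>m. b m * integral {0..pi} (\<lambda>x. sin (real (Suc m) * x) * sin (real (Suc n) * x)))
        = (\<lambda>m. if m = n then b m * (pi / 2) else 0)"
      unfolding integral_sin_mult_sin by auto
    ultimately have "(\<lambda>m. if m = n then b m * (pi / 2) else 0) sums integral {0..pi} (\<lambda>x. S x * sin (real (Suc n) * x))"
      by simp
    from sums_unique2[OF this sums_single[of n "\<lambda>m. b m * (pi / 2)"]] show ?thesis .
  qed
  have sine: "\<phi> x * sin x = S x" if "x \<in> {0..pi}" for x
  proof -
    have "\<phi> x * sin x - S x = 0"
    proof (rule sine_system_complete[OF _ _ that])
      fix n
      have "integral {0..pi} (\<lambda>x. \<phi> x * sin x * sin (real (Suc n) * x)) = b n * (pi / 2)"
        unfolding sine_coefficient_eq[OF cont] by (simp add: b_def f_def)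
      moreover have "integral {0..pi} (\<lambda>x. (\<phi> x * sin x - S x) * sin (real (Suc n) * x))
        = integral {0..pi} (\<lambda>x. \<phi> x * sin x * sin (real (Suc n) * x)) - integral {0..pi} (\<lambda>x. S x * sin (real (Suc n) * x))"
        unfolding left_diff_distrib
        by (intro integral_diff integrable_continuous_real continuous_intros cont cont_S)
      ultimately show "integral {0..pi} (\<lambda>x. (\<phi> x * sin x - S x) * sin (real (Suc n) * x)) = 0"
        by (simp only: S_coeff)
    qed (intro continuous_intros cont cont_S)
    then show ?thesis by simp
  qed
  \<comment> \<open>integrate the sine series over the short interval from \<open>0\<close> to \<open>1 / (N + 1)\<close>\<close>
  have nb: "summable (\<lambda>n. b n * real (Suc n))"
  proof (rule summableI_nonneg_bounded)
    fix N
    define e where "e = 1 / real (Suc N)"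
    have e: "0 < e" "e \<le> 1" by (auto simp: e_def)
    have e_pi: "e \<le> pi" using e pi_gt3 by linarith
    have int_sin: "integral {0..e} (\<lambda>x. sin (real (Suc n) * x) * 1) = (1 - cos (real (Suc n) * e)) / real (Suc n)" for n
    proof -
      have "((\<lambda>x. sin (real (Suc n) * x)) has_integral
          (- cos (real (Suc n) * e) / real (Suc n) - - cos (real (Suc n) * 0) / real (Suc n))) {0..e}"
        using e by (intro fundamental_theorem_of_calculus)
          (auto intro!: derivative_eq_intros simp flip: has_real_derivative_iff_has_vector_derivative simp del: of_nat_Suc)
      then show ?thesis by (simp add: integral_unique diff_divide_distrib del: of_nat_Suc)
    qed
    have "(\<lambda>n. b n * integral {0..e} (\<lambda>x. sin (real (Suc n) * x) * 1)) sums integral {0..e} (\<lambda>x. S x * 1)"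
      unfolding S_def by (rule sine_series_integral_sums[OF b_abs]) (rule continuous_on_const)
    then have sums: "(\<lambda>n. b n * ((1 - cos (real (Suc n) * e)) / real (Suc n))) sums integral {0..e} S"
      unfolding int_sin by simp
    \<comment> \<open>For \<open>n < N\<close> the argument \<open>(n + 1) * e\<close> is at most 1,
      so the quadratic bound applies to each of these terms, and positivity permits dropping the
      tail. The upper bound \<open>B * e\<^sup>2 / 2\<close> has the same order in \<open>e\<close>,
      which cancels and leaves \<open>4 * B\<close> for every \<open>N\<close>.\<close>
    have "(\<Sum>n<N. b n * real (Suc n)) * (e\<^sup>2 / 8) = (\<Sum>n<N. b n * ((real (Suc n) * e)\<^sup>2 / 8 / real (Suc n)))"
      unfolding sum_distrib_right by (intro sum.cong) (auto simp: power2_eq_square field_simps)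
    also have "\<dots> \<le> (\<Sum>n<N. b n * ((1 - cos (real (Suc n) * e)) / real (Suc n)))"
    proof (intro sum_mono mult_left_mono divide_right_mono one_minus_cos_ge)
      fix n assume "n \<in> {..<N}"
      then show "real (Suc n) * e \<le> 1" by (simp add: e_def field_simps)
    qed (use pos e in \<open>auto simp: less_imp_le\<close>)
    also have "\<dots> \<le> integral {0..e} S"
      unfolding sums_unique[OF sums]
      by (rule sum_le_suminf[OF sums_summable[OF sums]]) (use pos in \<open>auto simp: less_imp_le\<close>)
    also have "\<dots> = integral {0..e} (\<lambda>x. \<phi> x * sin x)"
      using e_pi by (intro integral_cong) (simp add: sine)
    also have "\<dots> \<le> integral {0..e} (\<lambda>x. B * x)"
    proof (rule integral_le)
      show "(\<lambda>x. \<phi> x * sin x) integrable_on {0..e}"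
        using e_pi by (intro integrable_continuous_real continuous_intros continuous_on_subset[OF cont]) auto
      fix x assume x: "x \<in> {0..e}"
      have "\<phi> x * sin x \<le> B * sin x"
        using B x e_pi by (intro mult_right_mono sin_ge_zero) (auto simp: abs_le_iff)
      also have "\<dots> \<le> B * x" using x B by (intro mult_left_mono sin_x_le_x) auto
      finally show "\<phi> x * sin x \<le> B * x" .
    qed (intro integrable_continuous_real continuous_intros)
    also have "\<dots> = B * (e\<^sup>2 / 2)" using e by (simp add: ident_has_integral integral_unique)
    finally have "(\<Sum>n<N. b n * real (Suc n)) * (e\<^sup>2 / 8) \<le> (4 * B) * (e\<^sup>2 / 8)" by simp
    then show "(\<Sum>n<N. b n * real (Suc n)) \<le> 4 * B"
      using e by (subst (asm) mult_le_cancel_right_pos) auto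
  qed (use pos in \<open>simp add: less_imp_le\<close>)
  define T where "T t = (\<Sum>n. b n * chebU n (cos t))" for t
  have bound: "norm (b n * chebU n (cos t)) \<le> b n * real (Suc n)" for n t
    using abs_chebU_le[of "cos t" n] pos[of n] by (simp add: abs_mult mult_left_mono)
  have "uniform_limit {0..pi} (\<lambda>N t. \<Sum>n<N. b n * chebU n (cos t)) T sequentially"
    unfolding T_def by (rule Weierstrass_m_test[OF bound nb])
  then have cont_T: "continuous_on {0..pi} T"
    by (rule uniform_limit_theorem[rotated]) (auto intro!: always_eventually continuous_intros)
  have summ: "summable (\<lambda>n. b n * chebU n (cos t))" for t
    by (rule summable_comparison_test'[OF nb bound])
  \<comment> \<open>Here \<open>sin t\<close> can be cancelled; the endpoints, among them the
    essential value at 0, follow from continuity of \<open>T\<close>.\<close>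
  have interior: "\<phi> t - T t = 0" if t: "t \<in> {0<..<pi}" for t
  proof -
    have "sin t * T t = (\<Sum>n. sin t * (b n * chebU n (cos t)))"
      unfolding T_def by (rule suminf_mult[OF summ, symmetric])
    also have "\<dots> = S t"
      unfolding S_def sin_mult_chebU_cos[symmetric] by (simp add: mult_ac)
    also have "\<dots> = sin t * \<phi> t" using sine[of t] t by (simp add: mult.commute)
    finally show ?thesis using sin_gt_zero[of t] t by simp
  qed
  have "continuous_on {0..pi} (\<lambda>t. \<phi> t - T t)"
    by (intro continuous_intros cont cont_T)
  then have "\<phi> t - T t = 0" if "t \<in> {0..pi}" for t
    using continuous_constant_on_closure[of "{0<..<pi}" "\<lambda>t. \<phi> t - T t" 0 t] interior that by simp
  then have "(\<lambda>n. b n * chebU n (cos t)) sums \<phi> t" if "t \<in> {0..pi}" for t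
    using that summable_sums[OF summ[of t]] by (simp add: T_def)
  with pos show thesis by (rule that)
qed

section \<open>Strict positive definiteness on the three-sphere\<close>

lemma chebU_series_strict_pos_def:
  fixes \<psi> :: "real \<Rightarrow> real"
  assumes pos: "\<And>n. b n > 0"
    and sums: "\<And>t. \<bar>t\<bar> \<le> 1 \<Longrightarrow> (\<lambda>n. b n * chebU n t) sums \<psi> t"
    and X: "X \<subseteq> sphere (0 :: real ^ 4) 1" "finite X"
  shows "(\<Sum>x\<in>X. \<Sum>y\<in>X. c x * c y * \<psi> (x \<bullet> y)) \<ge> 0"
    and "(\<Sum>x\<in>X. \<Sum>y\<in>X. c x * c y * \<psi> (x \<bullet> y)) = 0 \<Longrightarrow> y \<in> X \<Longrightarrow> c y = 0"
proof -
  define Q where "Q n = (\<Sum>x\<in>X. \<Sum>y\<in>X. c x * c y * chebU n (x \<bullet> y))" for n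
  have Q_nonneg: "Q n \<ge> 0" for n
    unfolding Q_def by (rule chebU_inner_quadratic_form[OF X(1)])
  have inner_le: "\<bar>x \<bullet> y\<bar> \<le> 1" if "x \<in> X" "y \<in> X" for x y
    using Cauchy_Schwarz_ineq2[of x y] that X(1) by (auto simp: subset_iff)
  have "(\<lambda>n. \<Sum>x\<in>X. \<Sum>y\<in>X. c x * c y * (b n * chebU n (x \<bullet> y))) sums (\<Sum>x\<in>X. \<Sum>y\<in>X. c x * c y * \<psi> (x \<bullet> y))"
    by (intro sums_sum sums_mult sums inner_le)
  then have Q_sums: "(\<lambda>n. b n * Q n) sums (\<Sum>x\<in>X. \<Sum>y\<in>X. c x * c y * \<psi> (x \<bullet> y))"
    by (simp add: Q_def sum_distrib_left mult_ac)
  have term_nonneg: "b n * Q n \<ge> 0" for n using pos[of n] Q_nonneg[of n] by simp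
  show "(\<Sum>x\<in>X. \<Sum>y\<in>X. c x * c y * \<psi> (x \<bullet> y)) \<ge> 0"
    using term_nonneg by (rule sums_le[OF _ sums_zero Q_sums])
  assume zero: "(\<Sum>x\<in>X. \<Sum>y\<in>X. c x * c y * \<psi> (x \<bullet> y)) = 0" and y: "y \<in> X"
  have "(\<Sum>n. b n * Q n) = 0" "summable (\<lambda>n. b n * Q n)"
    using Q_sums unfolding zero by (simp_all add: sums_iff)
  then have "b n * Q n = 0" for n
    using suminf_eq_zero_iff[of "\<lambda>n. b n * Q n"] term_nonneg by blast
  then have "Q n = 0" for n using pos[of n] by (metis less_irrefl mult_eq_0_iff)
  then have cheb0: "(\<Sum>x\<in>X. c x * chebU n (x \<bullet> y)) = 0" for n
    using chebU_inner_quadratic_form(2)[OF X(1), where c = c and n = n] y X(1) by (auto simp: Q_def)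
  have pow0: "(\<Sum>x\<in>X. c x * (x \<bullet> y) ^ k) = 0" for k
  proof -
    obtain a N where a: "\<And>t. t ^ k = (\<Sum>n\<le>N. a n * chebU n t)"
      using power_eq_sum_chebU by blast
    have "(\<Sum>x\<in>X. c x * (x \<bullet> y) ^ k) = (\<Sum>n\<le>N. a n * (\<Sum>x\<in>X. c x * chebU n (x \<bullet> y)))"
      unfolding a sum_distrib_left by (subst sum.swap) (simp add: mult_ac)
    then show ?thesis by (simp add: cheb0)
  qed
  \<comment> \<open>With \<open>y\<close> fixed in \<open>X\<close> only the numbers
    \<open>x \<bullet> y\<close> matter, so polynomials in one variable suffice to isolate
    \<open>c y\<close>.\<close>
  have poly0: "(\<Sum>x\<in>X. c x * poly p (x \<bullet> y)) = 0" for p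
  proof -
    have "(\<Sum>x\<in>X. c x * poly p (x \<bullet> y)) = (\<Sum>i\<le>degree p. coeff p i * (\<Sum>x\<in>X. c x * (x \<bullet> y) ^ i))"
      unfolding poly_altdef sum_distrib_left by (subst sum.swap) (simp add: mult_ac)
    then show ?thesis by (simp add: pow0)
  qed
  \<comment> \<open>a polynomial separating \<open>y \<bullet> y\<close> from the other inner products\<close>
  define p where "p = (\<Prod>z\<in>X - {y}. [:- (z \<bullet> y), 1:])"
  have "(\<Sum>x\<in>X. c x * poly p (x \<bullet> y)) = c y * poly p (y \<bullet> y) + (\<Sum>x\<in>X - {y}. c x * poly p (x \<bullet> y))"
    using X(2) y by (rule sum.remove)
  also have "(\<Sum>x\<in>X - {y}. c x * poly p (x \<bullet> y)) = 0"
    using X(2) by (intro sum.neutral ballI) (auto simp: p_def poly_prod intro!: prod_zero)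
  finally have "c y * poly p (y \<bullet> y) = 0" by (simp add: poly0)
  moreover have "poly p (y \<bullet> y) \<noteq> 0"
  proof -
    \<comment> \<open>Equality case of Cauchy-Schwarz: a unit vector with inner product 1 with
      \<open>y\<close> is \<open>y\<close> itself.\<close>
    have "y \<bullet> y \<noteq> z \<bullet> y" if "z \<in> X - {y}" for z
    proof
      assume eq: "y \<bullet> y = z \<bullet> y"
      have "norm z = 1" "norm y = 1" using that y X(1) by auto
      then have "(z - y) \<bullet> (z - y) = 0"
        using eq by (simp add: inner_diff inner_commute norm_eq_1)
      then show False using that by simp
    qed
    then show ?thesis using X(2) by (simp add: p_def poly_prod)
  qed
  ultimately show "c y = 0" by simp
qed

theorem theorem3:
  fixes \<phi> :: "real \<Rightarrow> real"
  assumes "\<phi> \<in> Phi_class TYPE(real ^ 3)"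
    and "\<And>t. t \<ge> pi \<Longrightarrow> \<phi> t = 0"
  shows "restrict \<phi> {0..pi} \<in> Psi_plus_class TYPE(real ^ 4)"
proof -
  have cont0: "continuous_on {0..} \<phi>" and one: "\<phi> 0 = 1"
    and pos_def: "pos_def_on (UNIV :: (real ^ 3) set) (\<lambda>x y. \<phi> (norm (x - y)))"
    using assms(1) by (auto simp: Phi_class_def)
  have cont: "continuous_on {0..pi} \<phi>" using cont0 by (rule continuous_on_subset) auto
  obtain b where b: "\<And>n. b n > 0" "\<And>t. t \<in> {0..pi} \<Longrightarrow> (\<lambda>n. b n * chebU n (cos t)) sums \<phi> t"
    using chebU_expansion[OF cont _ sine_transform_nonneg[OF pos_def cont0 pi_gt_zero assms(2)]] one
    by (metis zero_neq_one)
  define \<psi> where "\<psi> t = restrict \<phi> {0..pi} (arccos t)" for t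
  have sums: "(\<lambda>n. b n * chebU n t) sums \<psi> t" if "\<bar>t\<bar> \<le> 1" for t
  proof -
    \<comment> \<open>Outside \<open>{0..pi}\<close> the restricted function takes the value
      \<open>undefined\<close>; the arccosine never leads there.\<close>
    have "arccos t \<in> {0..pi}" using that by (auto simp: abs_le_iff arccos_lbound arccos_ubound)
    then show ?thesis using b(2)[of "arccos t"] that by (simp add: \<psi>_def cos_arccos_abs)
  qed
  \<comment> \<open>Distinctness of the points allows the coefficients to be attached to the points
    themselves, through \<open>inv_into\<close>, so that the result for finite sets applies.\<close>
  have reindex: "(\<Sum>i=1..n. \<Sum>j=1..n. c i * c j * restrict \<phi> {0..pi} (great_circle_dist (x i) (x j)))
     = (\<Sum>u\<in>x ` {1..n}. \<Sum>v\<in>x ` {1..n}. c (inv_into {1..n} x u) * c (inv_into {1..n} x v) * \<psi> (u \<bullet> v))"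
    if "inj_on x {1..n}" for n c and x :: "nat \<Rightarrow> real ^ 4"
    using that by (simp add: sum.reindex great_circle_dist_def \<psi>_def)
  have pos: "pos_def_on (sphere (0 :: real ^ 4) 1) (\<lambda>x y. restrict \<phi> {0..pi} (great_circle_dist x y))"
    unfolding pos_def_on_def
  proof (intro allI impI, elim conjE)
    fix n and x :: "nat \<Rightarrow> real ^ 4" and c :: "nat \<Rightarrow> real"
    assume x: "x ` {1..n} \<subseteq> sphere 0 1" "inj_on x {1..n}"
    show "(\<Sum>i=1..n. \<Sum>j=1..n. c i * c j * restrict \<phi> {0..pi} (great_circle_dist (x i) (x j))) \<ge> 0"
      unfolding reindex[OF x(2)] by (rule chebU_series_strict_pos_def[OF b(1) sums x(1)]) auto
  qed
  have strict: "(\<Sum>i=1..n. \<Sum>j=1..n. c i * c j * restrict \<phi> {0..pi} (great_circle_dist (x i) (x j))) > 0"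
    if x: "x ` {1..n} \<subseteq> sphere 0 1" "inj_on x {1..n}" and c: "\<not> (\<forall>i\<in>{1..n}. c i = 0)"
    for n c and x :: "nat \<Rightarrow> real ^ 4"
  proof (rule ccontr)
    let ?Q = "\<Sum>i=1..n. \<Sum>j=1..n. c i * c j * restrict \<phi> {0..pi} (great_circle_dist (x i) (x j))"
    assume "\<not> ?Q > 0"
    moreover have "?Q \<ge> 0" using pos x unfolding pos_def_on_def by blast
    ultimately have Q0: "?Q = 0" by simp
    have "c i = 0" if "i \<in> {1..n}" for i
    proof -
      have "c (inv_into {1..n} x (x i)) = 0"
        by (rule chebU_series_strict_pos_def(2)[OF b(1) sums x(1) _ Q0[unfolded reindex[OF x(2)]]]) (use that in auto)
      then show ?thesis using x(2) that by simp
    qed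
    with c show False by blast
  qed
  have "continuous_on {0..pi} (restrict \<phi> {0..pi})"
    using cont by (rule continuous_on_eq) simp
  then show ?thesis
    using pos strict one by (auto simp: Psi_plus_class_def strict_pos_def_on_def)
qed

end
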